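(* Let $\lambda$ be an infinite cardinal. Let $\kappa$ be a cardinal satisfying the following condition: for every coloring $c$ of $[\kappa]^{<\omega}$ in $3$ colors, there exist an unmeshed family $H$ of finite subsets of $\kappa$ of cardinality $\lambda$ and an even integer $b>0$ such that $FU^{\{b\}}(H)$ is monochromatic under $c$. Then $\kappa\to(\lambda)^2_2$.
   Context: $[\kappa]^{<\omega}$ denotes the set of finite subsets of $\kappa$, where $\kappa$ is identified with an initial ordinal and carries its ordinal ordering. A coloring of a set $S$ in $3$ colors is a function $c:S\to\{0,1,2\}$; a subset of $S$ is monochromatic under $c$ if $c$ is constant on it. For a set $A$ of positive integers and a family $H$ of sets, $FU^A(H)$ denotes the set of all unions $x_1\cup\dots\cup x_j$ of $j$ many distinct members $x_1,\dots,x_j$ of $H$, for $j\in A$. Two finite non-empty subsets $x,y$ of $\kappa$ are unmeshed if either $\max x<\min y$ or $\max y<\min x$. A family of finite non-empty subsets of $\kappa$ is unmeshed (pairwise unmeshed) if any two distinct members of it are unmeshed. The notation $\kappa\to(\lambda)^2_2$ means: if the pairs (two-element subsets) of a set of cardinality $\kappa$ are colored in two colors, then there exists a subset of cardinality $\lambda$ all of whose pairs have the same color. *)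

theory Defs
  imports "HOL-Library.Ramsey"
begin

unbundle cardinal_syntax

text \<open>
  A cardinal is a relation \<open>\<kappa>\<close> with \<open>Card_order \<kappa>\<close>, that is, a well-order of minimal
  order type among the well-orders of its field. It thus plays the role of an initial ordinal:
  its elements are those of \<open>Field \<kappa>\<close> and its ordinal ordering is \<open>\<kappa>\<close> itself.
  The set of finite subsets of \<open>\<kappa>\<close> is \<open>Fpow (Field \<kappa>)\<close>, and a set \<open>X\<close> has
  cardinality \<open>\<kappa>\<close> if \<open>|X| =o \<kappa>\<close>.
\<close>

definition coloring :: "nat \<Rightarrow> 'a set \<Rightarrow> ('a \<Rightarrow> nat) \<Rightarrow> bool" where
  "coloring k S c \<longleftrightarrow> c \<in> S \<rightarrow> {..<k}"

definition mono_under :: "('a \<Rightarrow> nat) \<Rightarrow> 'a set \<Rightarrow> bool" where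
  "mono_under c T \<longleftrightarrow> (\<exists>i. \<forall>x\<in>T. c x = i)"

definition FU :: "nat set \<Rightarrow> 'a set set \<Rightarrow> 'a set set" where
  "FU A H = {\<Union>X | X. X \<subseteq> H \<and> finite X \<and> card X \<in> A}"

text \<open>Maximum and minimum in the order \<open>r\<close>, meaningful for finite non-empty sets.\<close>

definition ord_max :: "'a rel \<Rightarrow> 'a set \<Rightarrow> 'a" where
  "ord_max r x = (THE m. m \<in> x \<and> (\<forall>a\<in>x. (a, m) \<in> r))"

definition ord_min :: "'a rel \<Rightarrow> 'a set \<Rightarrow> 'a" where
  "ord_min r x = (THE m. m \<in> x \<and> (\<forall>a\<in>x. (m, a) \<in> r))"

definition unmeshed :: "'a rel \<Rightarrow> 'a set \<Rightarrow> 'a set \<Rightarrow> bool" where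
  "unmeshed r x y \<longleftrightarrow>
     (ord_max r x, ord_min r y) \<in> r - Id \<or> (ord_max r y, ord_min r x) \<in> r - Id"

definition unmeshed_family :: "'a rel \<Rightarrow> 'a set set \<Rightarrow> bool" where
  "unmeshed_family r H \<longleftrightarrow>
     H \<subseteq> Fpow (Field r) - {{}} \<and> (\<forall>x\<in>H. \<forall>y\<in>H. x \<noteq> y \<longrightarrow> unmeshed r x y)"

text \<open>
  The partition relation \<open>\<kappa> \<rightarrow> (\<lambda>)\<^sup>2\<^sub>2\<close>. The sets \<open>S\<close> range over the element type of
  \<open>\<kappa>\<close>; this is no restriction, as the lemma below shows.
\<close>

definition arrows_pairs :: "'a rel \<Rightarrow> 'b rel \<Rightarrow> bool" where
  "arrows_pairs \<kappa> l \<longleftrightarrow>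
     (\<forall>(S :: 'a set) f. |S| =o \<kappa> \<and> coloring 2 ([S]\<^bsup>2\<^esup>) f \<longrightarrow>
        (\<exists>T\<subseteq>S. |T| =o l \<and> mono_under f ([T]\<^bsup>2\<^esup>)))"

lemma arrows_pairs_any_type:
  fixes S :: "'c set"
  assumes arr: "arrows_pairs \<kappa> l" and \<kappa>: "Card_order \<kappa>"
    and S: "|S| =o \<kappa>" and f: "coloring 2 ([S]\<^bsup>2\<^esup>) f"
  shows "\<exists>T\<subseteq>S. |T| =o l \<and> mono_under f ([T]\<^bsup>2\<^esup>)"
proof -
  have F: "|Field \<kappa>| =o \<kappa>"
    using \<kappa> by (rule card_of_Field_ordIso)
  then have "|Field \<kappa>| =o |S|"
    using S ordIso_symmetric ordIso_transitive by blast
  then obtain h where h: "bij_betw h (Field \<kappa>) S"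
    using card_of_ordIso by blast
  then have inj: "inj_on h (Field \<kappa>)" and im: "h ` Field \<kappa> = S"
    by (auto simp: bij_betw_def)
  have img: "h ` p \<in> [h ` T]\<^bsup>2\<^esup>" if "p \<in> [T]\<^bsup>2\<^esup>" "T \<subseteq> Field \<kappa>" for p T
    using that inj by (auto simp: nsets_def card_image inj_on_subset)
  have "coloring 2 ([Field \<kappa>]\<^bsup>2\<^esup>) (\<lambda>p. f (h ` p))"
    using f img[of _ "Field \<kappa>"] im by (auto simp: coloring_def Pi_iff)
  then obtain T where T: "T \<subseteq> Field \<kappa>" "|T| =o l" "mono_under (\<lambda>p. f (h ` p)) ([T]\<^bsup>2\<^esup>)"
    using arr F unfolding arrows_pairs_def by blast
  have injT: "inj_on h T"
    using inj T(1) by (rule inj_on_subset)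
  then have "|h ` T| =o l"
    using T(2) by (meson card_of_ordIso inj_on_imp_bij_betw ordIso_symmetric ordIso_transitive)
  moreover have "mono_under f ([h ` T]\<^bsup>2\<^esup>)"
  proof -
    obtain i where i: "\<And>p. p \<in> [T]\<^bsup>2\<^esup> \<Longrightarrow> f (h ` p) = i"
      using T(3) by (auto simp: mono_under_def)
    have "f q = i" if q: "q \<in> [h ` T]\<^bsup>2\<^esup>" for q
    proof -
      obtain x y where xy: "q = {h x, h y}" "x \<in> T" "y \<in> T" "x \<noteq> y"
        using q by (elim nsets2_E) auto
      then show ?thesis
        using i[of "{x, y}"] by simp
    qed
    then show ?thesis by (auto simp: mono_under_def)
  qed
  moreover have "h ` T \<subseteq> S" using T(1) im by blast
  ultimately show ?thesis by blast
qed

end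

theory Submission
  imports Defs
begin

text \<open>
  Suppose that a colouring \<open>f\<close> of the pairs of \<open>\<kappa>\<close> has no homogeneous set of size \<open>\<lambda>\<close>. For
  countable \<open>\<lambda>\<close> this contradicts Ramsey's theorem, so let \<open>\<lambda>\<close> be uncountable.

  A pair can be read off from a union of evenly many blocks: if \<open>x\<^sub>1 < \<dots> < x\<^sub>b\<close> are unmeshed
  sets of equal size and \<open>b\<close> is even, then the minimum of the union is \<open>min x\<^sub>1\<close>, and the element
  that opens the upper half of the union is the minimum of \<open>x\<^bsub>b/2+1\<^esub>\<close>. Hence the colouring of
  finite sets \<open>x \<mapsto> f {min x, middle x}\<close> sees exactly the pairs of minima of equally large members
  of \<open>H\<close>, as long as enough members of \<open>H\<close> of this size lie between the two and above the second.
  Both are achieved by splitting the minima into countably many pieces, and on each piece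
  \<open>f\<close> is homogeneous. If \<open>\<lambda>\<close> has uncountable cofinality, one of the pieces has size \<open>\<lambda>\<close>, which is
  a contradiction.

  If all pieces are smaller than \<open>\<lambda>\<close>, then \<open>\<lambda>\<close> is the union of an increasing sequence
  of sets \<open>X\<^sub>n\<close> of smaller size, and here the third colour comes in. By the Erdos-Rado tree argument,
  as \<open>f\<close> has no homogeneous set of size \<open>\<lambda>\<close>, the cardinal \<open>\<kappa>\<close> is a union of countably many sets, the
  \<open>n\<close>-th of size at most \<open>2\<close> to the power \<open>|X\<^sub>n|\<close> (\<open>end_homogeneous_cover\<close>). Therefore \<open>\<kappa>\<close> splits into countably many
  intervals, indexed monotonically by some \<open>\<beta>\<close>, such that the interval with index \<open>n\<close> has
  at most so many elements (\<open>card_of_small_initial_segments\<close>) and so carries a Sierpinski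
  colouring whose homogeneous sets have at most \<open>|X\<^sub>n|\<close> elements (\<open>sierpinski\<close>). Give a finite set
  the colour \<open>2\<close> if it meets more than one interval, and otherwise evaluate the Sierpinski colouring
  of its interval at the minimum and the middle. A monochromatic family of unions
  cannot have colour \<open>2\<close>, since infinitely many members of \<open>H\<close> have both their
  minimum and their maximum in the same pair of intervals, and
  unmeshedness makes these two intervals equal. In the other colours, \<open>H\<close> lies in a single
  interval, and \<open>H\<close> is a countable union of pieces of size at most \<open>|X\<^sub>n|\<close>. This contradicts
  \<open>|X\<^sub>n| < \<lambda>\<close>.

  The two applications of the hypothesis are instances of \<open>homogeneous_pieces\<close>: with one interval
  and \<open>f\<close> itself for the first, and with \<open>\<beta>\<close> and the Sierpinski colourings for the second.
\<close>

section \<open>Strict well-orders and homogeneous sets\<close>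

definition prec :: "'a \<Rightarrow> 'a rel \<Rightarrow> 'a \<Rightarrow> bool" ("(_ \<prec>\<^bsub>_\<^esub> _)" [51, 0, 51] 50) where
  "a \<prec>\<^bsub>r\<^esub> b \<longleftrightarrow> (a, b) \<in> r - Id"

lemma prec_irrefl [simp]: "\<not> a \<prec>\<^bsub>r\<^esub> a"
  by (simp add: prec_def)

lemma prec_trans: "Well_order r \<Longrightarrow> a \<prec>\<^bsub>r\<^esub> b \<Longrightarrow> b \<prec>\<^bsub>r\<^esub> c \<Longrightarrow> a \<prec>\<^bsub>r\<^esub> c"
  unfolding prec_def well_order_on_def linear_order_on_def partial_order_on_def preorder_on_def
  by (metis Diff_iff antisymD pair_in_Id_conv transD)

lemma prec_asym: "Well_order r \<Longrightarrow> a \<prec>\<^bsub>r\<^esub> b \<Longrightarrow> \<not> b \<prec>\<^bsub>r\<^esub> a"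
  using prec_trans by fastforce

lemma prec_total:
  "Well_order r \<Longrightarrow> a \<in> Field r \<Longrightarrow> b \<in> Field r \<Longrightarrow> a \<prec>\<^bsub>r\<^esub> b \<or> a = b \<or> b \<prec>\<^bsub>r\<^esub> a"
  unfolding prec_def well_order_on_def linear_order_on_def total_on_def by auto

lemma prec_Field: "a \<prec>\<^bsub>r\<^esub> b \<Longrightarrow> a \<in> Field r" "a \<prec>\<^bsub>r\<^esub> b \<Longrightarrow> b \<in> Field r"
  by (auto simp: prec_def Field_def)

lemma underS_prec: "underS r a = {b. b \<prec>\<^bsub>r\<^esub> a}"
  by (auto simp: underS_def prec_def)

lemma wf_prec: "Well_order r \<Longrightarrow> wf (r - Id)"
  by (simp add: well_order_on_def)

lemma prec_induct [consumes 1, case_names less]: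
  assumes "Well_order r" and "\<And>a. (\<And>b. b \<prec>\<^bsub>r\<^esub> a \<Longrightarrow> P b) \<Longrightarrow> P a"
  shows "P a"
  using wf_induct_rule[OF wf_prec[OF assms(1)], of P a] assms(2) unfolding prec_def by blast

lemma least_element:
  assumes "Well_order r" "A \<subseteq> Field r" "A \<noteq> {}"
  obtains a where "a \<in> A" "\<And>b. b \<in> A \<Longrightarrow> b = a \<or> a \<prec>\<^bsub>r\<^esub> b"
proof -
  obtain x where "x \<in> A" using assms(3) by blast
  then obtain a where a: "a \<in> A" "\<And>b. (b, a) \<in> r - Id \<Longrightarrow> b \<notin> A"
    using wf_prec[OF assms(1)] by (metis wfE_min)
  moreover have "b = a \<or> a \<prec>\<^bsub>r\<^esub> b" if "b \<in> A" for b
    using a that prec_total[OF assms(1), of a b] assms(2) unfolding prec_def by blast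
  ultimately show thesis using that by blast
qed

definition homogeneous :: "('a set \<Rightarrow> bool) \<Rightarrow> 'a set \<Rightarrow> bool" where
  "homogeneous g T \<longleftrightarrow> (\<exists>i. \<forall>x\<in>T. \<forall>y\<in>T. x \<noteq> y \<longrightarrow> g {x, y} = i)"

section \<open>Sierpinski colourings\<close>

text \<open>
  The set \<open>S\<close> is lexicographically smaller than \<open>T\<close>, when sets are read as \<open>0\<close>-\<open>1\<close>-sequences along
  \<open>R\<close>, and \<open>d\<close> is the first place at which they differ.
\<close>

definition lex_at :: "'x rel \<Rightarrow> 'x set \<Rightarrow> 'x set \<Rightarrow> 'x \<Rightarrow> bool" where
  "lex_at R S T d \<longleftrightarrow> d \<notin> S \<and> d \<in> T \<and> S \<inter> underS R d = T \<inter> underS R d"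

lemma lex_at_total:
  assumes R: "Well_order R" and ST: "S \<subseteq> Field R" "T \<subseteq> Field R" "S \<noteq> T"
  shows "(\<exists>d\<in>Field R. lex_at R S T d) \<or> (\<exists>d\<in>Field R. lex_at R T S d)"
proof -
  let ?D = "(S - T) \<union> (T - S)"
  obtain d where d: "d \<in> ?D" "\<And>e. e \<in> ?D \<Longrightarrow> e = d \<or> d \<prec>\<^bsub>R\<^esub> e"
    using least_element[OF R, of ?D] ST by blast
  then have "S \<inter> underS R d = T \<inter> underS R d"
    using prec_asym[OF R] by (fastforce simp: underS_prec)
  then show ?thesis
    using d(1) ST unfolding lex_at_def by blast
qed

lemma lex_at_complement:
  assumes "lex_at R S T d" "d \<in> Field R"
  shows "lex_at R (Field R - T) (Field R - S) d"
  using assms unfolding lex_at_def by blast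

text \<open>
  Consecutive members \<open>a\<close> and \<open>s a\<close> of \<open>T\<close> split at some node of the binary tree, namely at the
  common restriction of \<open>\<phi> a\<close> and \<open>\<phi> (s a)\<close> to their first difference \<open>\<delta> a\<close>. No two members of
  \<open>T\<close> split at the same node: after \<open>s a\<close> the sequences have left the lower branch at that node
  for good. So \<open>T\<close> injects into the set of nodes
  over \<open>D\<close>, up to a possible last element that has no successor.
\<close>

lemma card_lex_increasing_aux:
  assumes r: "Well_order r" and R: "Well_order R" and inf: "infinite (Field R)"
    and T: "T \<subseteq> Field r" and D: "D \<subseteq> Field R"
    and lex: "\<And>a b. a \<in> T \<Longrightarrow> b \<in> T \<Longrightarrow> a \<prec>\<^bsub>r\<^esub> b \<Longrightarrow> \<exists>d\<in>D. lex_at R (\<phi> a) (\<phi> b) d"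
    and small: "\<And>d. d \<in> D \<Longrightarrow> |(\<lambda>a. \<phi> a \<inter> underS R d) ` T| \<le>o |Field R|"
  shows "|T| \<le>o |Field R|"
proof -
  \<comment> \<open>All members of \<open>T\<close> but a possible last one; these have a successor in \<open>T\<close>.\<close>
  define U where "U = {a\<in>T. \<exists>b\<in>T. a \<prec>\<^bsub>r\<^esub> b}"
  have "\<forall>a\<in>U. \<exists>b. b \<in> T \<and> a \<prec>\<^bsub>r\<^esub> b \<and> (\<forall>c\<in>T. a \<prec>\<^bsub>r\<^esub> c \<longrightarrow> c = b \<or> b \<prec>\<^bsub>r\<^esub> c)"
  proof
    fix a assume "a \<in> U"
    then have "{b\<in>T. a \<prec>\<^bsub>r\<^esub> b} \<noteq> {}" "{b\<in>T. a \<prec>\<^bsub>r\<^esub> b} \<subseteq> Field r"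
      using T by (auto simp: U_def)
    from least_element[OF r this(2,1)]
    obtain b where b: "b \<in> {b\<in>T. a \<prec>\<^bsub>r\<^esub> b}"
      "\<And>c. c \<in> {b\<in>T. a \<prec>\<^bsub>r\<^esub> b} \<Longrightarrow> c = b \<or> b \<prec>\<^bsub>r\<^esub> c" by blast
    then show "\<exists>b. b \<in> T \<and> a \<prec>\<^bsub>r\<^esub> b \<and> (\<forall>c\<in>T. a \<prec>\<^bsub>r\<^esub> c \<longrightarrow> c = b \<or> b \<prec>\<^bsub>r\<^esub> c)"
      by (intro exI[of _ b]) auto
  qed
  from bchoice[OF this] obtain s where s: "\<And>a. a \<in> U \<Longrightarrow> s a \<in> T \<and> a \<prec>\<^bsub>r\<^esub> s a"
    and s_least: "\<And>a c. a \<in> U \<Longrightarrow> c \<in> T \<Longrightarrow> a \<prec>\<^bsub>r\<^esub> c \<Longrightarrow> c = s a \<or> s a \<prec>\<^bsub>r\<^esub> c"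
    by blast
  have UT: "U \<subseteq> T" by (auto simp: U_def)
  have "\<forall>a\<in>U. \<exists>d\<in>D. lex_at R (\<phi> a) (\<phi> (s a)) d"
    using lex s UT by blast
  then obtain \<delta> where \<delta>: "\<And>a. a \<in> U \<Longrightarrow> \<delta> a \<in> D \<and> lex_at R (\<phi> a) (\<phi> (s a)) (\<delta> a)"
    by metis
  let ?node = "\<lambda>a. (\<delta> a, \<phi> a \<inter> underS R (\<delta> a))"
  \<comment> \<open>If \<open>a\<close> and a later \<open>b\<close> split at the same node, then \<open>s a\<close> lies above \<open>b\<close> lexicographically.\<close>
  have neq: "?node a \<noteq> ?node b" if ab: "a \<in> U" "b \<in> U" "a \<prec>\<^bsub>r\<^esub> b" for a b
  proof
    assume eq: "?node a = ?node b"
    let ?d = "\<delta> a"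
    have eq1: "\<delta> b = ?d"
      using eq by (metis prod.inject)
    have eq2: "\<phi> a \<inter> underS R ?d = \<phi> b \<inter> underS R ?d"
      using eq eq1 by (metis prod.inject)
    have a': "?d \<in> \<phi> (s a)" "\<phi> (s a) \<inter> underS R ?d = \<phi> b \<inter> underS R ?d"
      using \<delta>[OF ab(1)] eq2 unfolding lex_at_def by blast+
    have b': "?d \<notin> \<phi> b"
      using \<delta>[OF ab(2)] unfolding lex_at_def eq1 by blast
    then have "s a \<prec>\<^bsub>r\<^esub> b"
      using s_least[OF ab(1) _ ab(3)] ab UT a' by blast
    then obtain e where e: "e \<in> D" "lex_at R (\<phi> (s a)) (\<phi> b) e"
      using lex[of "s a" b] s ab UT by blast
    have "e \<prec>\<^bsub>R\<^esub> ?d \<or> e = ?d \<or> ?d \<prec>\<^bsub>R\<^esub> e"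
      using prec_total[OF R, of e ?d] e(1) D \<delta>[OF ab(1)] by blast
    then show False
      using e(2) a' b' unfolding lex_at_def underS_prec by blast
  qed
  have inj: "inj_on ?node U"
  proof (rule inj_onI)
    fix a b assume "a \<in> U" "b \<in> U" "?node a = ?node b"
    then show "a = b"
      using neq[of a b] neq[of b a] prec_total[OF r, of a b] UT T by (metis subsetD)
  qed
  have "?node ` U \<subseteq> (SIGMA d : D. (\<lambda>a. \<phi> a \<inter> underS R d) ` T)"
    using \<delta> UT by auto
  then have "|U| \<le>o |SIGMA d : D. (\<lambda>a. \<phi> a \<inter> underS R d) ` T|"
    using inj card_of_ordLeq by blast
  also have "|SIGMA d : D. (\<lambda>a. \<phi> a \<inter> underS R d) ` T| \<le>o |Field R|"
    by (rule card_of_Sigma_ordLeq_infinite[OF inf card_of_mono1[OF D]]) (use small in blast)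
  finally have U: "|U| \<le>o |Field R|" .
  have "\<exists>z. T \<subseteq> U \<union> {z}"
  proof (cases "T \<subseteq> U")
    case False
    then obtain z where z: "z \<in> T" "z \<notin> U" by blast
    have "a \<in> U" if "a \<in> T" "a \<noteq> z" for a
      using prec_total[OF r, of a z] that z T unfolding U_def by blast
    then show ?thesis by blast
  qed blast
  then obtain z where "T \<subseteq> U \<union> {z}" by blast
  then have "|T| \<le>o |U \<union> {z}|" by (rule card_of_mono1)
  also have "|U \<union> {z}| \<le>o |Field R|"
  proof -
    have "Field R \<noteq> {}" using inf by auto
    then have "|{z}| \<le>o |Field R|" by (rule card_of_singl_ordLeq)
    then show ?thesis
      by (rule card_of_Un_ordLeq_infinite_Field
          [of "|Field R|", unfolded Field_card_of, OF inf U _ card_of_card_order_on])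
  qed
  finally show ?thesis .
qed

text \<open>
  The tree of all \<open>0\<close>-\<open>1\<close>-sequences may have more than \<open>|Field R|\<close> nodes, but only the nodes through
  which \<open>T\<close> passes matter. By induction on the level \<open>\<xi>\<close> these are few: choosing one member of \<open>T\<close> for
  each node at level \<open>\<xi>\<close> gives a well-ordered increasing family whose differences lie below \<open>\<xi>\<close>.
\<close>

lemma card_lex_increasing:
  assumes r: "Well_order r" and R: "Well_order R" and inf: "infinite (Field R)"
    and T: "T \<subseteq> Field r"
    and lex: "\<And>a b. a \<in> T \<Longrightarrow> b \<in> T \<Longrightarrow> a \<prec>\<^bsub>r\<^esub> b \<Longrightarrow> \<exists>d\<in>Field R. lex_at R (\<phi> a) (\<phi> b) d"
  shows "|T| \<le>o |Field R|"
proof -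
  have restr: "|(\<lambda>a. \<phi> a \<inter> underS R \<xi>) ` T| \<le>o |Field R|" for \<xi>
    using R
  proof (induction \<xi> rule: prec_induct)
    case (less \<xi>)
    obtain U where U: "U \<subseteq> T" "inj_on (\<lambda>a. \<phi> a \<inter> underS R \<xi>) U"
      "(\<lambda>a. \<phi> a \<inter> underS R \<xi>) ` T = (\<lambda>a. \<phi> a \<inter> underS R \<xi>) ` U"
      using subset_image_inj[THEN iffD1, OF order_refl[of "(\<lambda>a. \<phi> a \<inter> underS R \<xi>) ` T"]] by blast
    have "|U| \<le>o |Field R|"
    proof (rule card_lex_increasing_aux[OF r R inf, where D = "underS R \<xi>" and \<phi> = \<phi>])
      show "U \<subseteq> Field r" using U T by blast
      show "underS R \<xi> \<subseteq> Field R" by (auto simp: underS_def Field_def)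
    next
      fix a b assume ab: "a \<in> U" "b \<in> U" "a \<prec>\<^bsub>r\<^esub> b"
      then obtain d where d: "d \<in> Field R" "lex_at R (\<phi> a) (\<phi> b) d"
        using lex[of a b] U by blast
      have "\<phi> a \<inter> underS R \<xi> \<noteq> \<phi> b \<inter> underS R \<xi>"
        using ab U(2) by (metis inj_onD prec_irrefl)
      then obtain e where e: "e \<prec>\<^bsub>R\<^esub> \<xi>" "e \<in> \<phi> a \<longleftrightarrow> e \<notin> \<phi> b"
        by (auto simp: underS_prec)
      have "\<not> e \<prec>\<^bsub>R\<^esub> d"
        using d(2) e(2) unfolding lex_at_def underS_prec by blast
      then have "d = e \<or> d \<prec>\<^bsub>R\<^esub> e"
        using prec_total[OF R, of d e] d(1) prec_Field[OF e(1)] by blast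
      then have "d \<prec>\<^bsub>R\<^esub> \<xi>"
        using prec_trans[OF R] e(1) by blast
      then show "\<exists>d\<in>underS R \<xi>. lex_at R (\<phi> a) (\<phi> b) d"
        using d(2) by (auto simp: underS_prec)
    next
      fix d assume "d \<in> underS R \<xi>"
      then have "|(\<lambda>a. \<phi> a \<inter> underS R d) ` T| \<le>o |Field R|"
        by (intro less.IH) (simp add: underS_prec)
      then show "|(\<lambda>a. \<phi> a \<inter> underS R d) ` U| \<le>o |Field R|"
        using ordLeq_transitive[OF card_of_mono1[OF image_mono[OF U(1)]]] by blast
    qed
    then show ?case
      unfolding U(3) using card_of_image ordLeq_transitive by blast
  qed
  show ?thesis
    by (rule card_lex_increasing_aux[OF r R inf T order_refl, of \<phi>]) (use lex restr in auto)
qed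

text \<open>
  Compare the given well-order with the lexicographic order of the power set. A set
  homogeneous for agreement is a well-ordered increasing family of subsets of \<open>X\<close>; a set
  homogeneous for disagreement is decreasing, and complements turn it into an increasing one.
\<close>

lemma sierpinski:
  assumes r: "Well_order r" and A: "A \<subseteq> Field r" and inf: "infinite X" and le: "|A| \<le>o |Pow X|"
  obtains g :: "'a set \<Rightarrow> bool"
  where "\<And>T. T \<subseteq> A \<Longrightarrow> homogeneous g T \<Longrightarrow> |T| \<le>o |X|"
proof -
  let ?R = "|X|"
  have R: "Well_order ?R" "Field ?R = X"
    by (rule card_of_Well_order, rule Field_card_of)
  obtain \<phi> where \<phi>: "inj_on \<phi> A" "\<phi> ` A \<subseteq> Pow X"
    using le card_of_ordLeq[of A "Pow X"] by blast
  define g where "g p \<longleftrightarrow> (\<exists>a b. p = {a, b} \<and> a \<prec>\<^bsub>r\<^esub> b \<and> (\<exists>d\<in>X. lex_at ?R (\<phi> a) (\<phi> b) d))" for p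
  have g: "g {a, b} \<longleftrightarrow> (\<exists>d\<in>X. lex_at ?R (\<phi> a) (\<phi> b) d)" if "a \<prec>\<^bsub>r\<^esub> b" for a b
  proof
    assume "g {a, b}"
    then obtain a' b' where "{a, b} = {a', b'}" "a' \<prec>\<^bsub>r\<^esub> b'" "\<exists>d\<in>X. lex_at ?R (\<phi> a') (\<phi> b') d"
      unfolding g_def by blast
    moreover from this have "a' = a \<and> b' = b"
      using prec_asym[OF r that] by (metis doubleton_eq_iff)
    ultimately show "\<exists>d\<in>X. lex_at ?R (\<phi> a) (\<phi> b) d" by simp
  next
    assume "\<exists>d\<in>X. lex_at ?R (\<phi> a) (\<phi> b) d"
    then show "g {a, b}" using that unfolding g_def by blast
  qed
  have "|T| \<le>o |X|" if T: "T \<subseteq> A" "homogeneous g T" for T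
  proof -
    obtain i where i: "\<And>a b. a \<in> T \<Longrightarrow> b \<in> T \<Longrightarrow> a \<noteq> b \<Longrightarrow> g {a, b} = i"
      using T(2) unfolding homogeneous_def by (elim exE) simp
    have TF: "T \<subseteq> Field r" using T A by blast
    have *: "g {a, b} = i" if "a \<in> T" "b \<in> T" "a \<prec>\<^bsub>r\<^esub> b" for a b
      using i[OF that(1,2)] that(3) prec_irrefl[of a r] by blast
    show ?thesis
    proof (cases i)
      case True
      then show ?thesis
        using card_lex_increasing[OF r R(1) _ TF, of \<phi>] * g inf unfolding R(2) by blast
    next
      case False
      have "\<exists>d\<in>X. lex_at ?R (X - \<phi> a) (X - \<phi> b) d" if ab: "a \<in> T" "b \<in> T" "a \<prec>\<^bsub>r\<^esub> b" for a b
      proof -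
        have "\<phi> a \<noteq> \<phi> b" "\<phi> a \<subseteq> X" "\<phi> b \<subseteq> X"
          using ab T(1) \<phi> by (auto dest: inj_onD)
        moreover have "\<not> (\<exists>d\<in>X. lex_at ?R (\<phi> a) (\<phi> b) d)"
          using *[OF ab] g[OF ab(3)] False by simp
        ultimately obtain d where "d \<in> X" "lex_at ?R (\<phi> b) (\<phi> a) d"
          using lex_at_total[OF R(1), of "\<phi> a" "\<phi> b"] unfolding R(2) by blast
        then show ?thesis
          using lex_at_complement[of ?R "\<phi> b" "\<phi> a" d] unfolding R(2) by blast
      qed
      then show ?thesis
        using card_lex_increasing[OF r R(1) _ TF, of "\<lambda>a. X - \<phi> a"] inf unfolding R(2) by blast
    qed
  qed
  then show thesis using that by blast
qed

section \<open>The Erdos-Rado tree\<close>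

lemma card_leq_or_less: "|A| \<le>o |B| \<or> |B| <o |A|"
  using ordLess_or_ordLeq[OF card_of_Well_order card_of_Well_order] by blast

lemma countable_cover_leq:
  fixes B :: "nat \<Rightarrow> 'a set"
  assumes "infinite Y" "M \<subseteq> (\<Union>n. B n)" "\<And>n. |B n| \<le>o |Y|"
  shows "|M| \<le>o |Y|"
proof -
  have "|\<Union>n. B n| \<le>o |Y|"
    using card_of_UNION_ordLeq_infinite[OF assms(1), of UNIV B] assms(1,3)
    by (simp add: infinite_iff_card_of_nat)
  then show ?thesis
    using card_of_mono1[OF assms(2)] ordLeq_transitive by blast
qed

text \<open>
  The Erdos-Rado tree of a colouring \<open>f\<close>: an element \<open>b\<close> precedes \<open>a\<close> if it is smaller and each
  tree predecessor of \<open>b\<close> has the same colour with \<open>b\<close> as with \<open>a\<close>. The equation determines the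
  relation by recursion on \<open>b\<close>.
\<close>

lemma end_homogeneous_tree:
  fixes f :: "'a set \<Rightarrow> bool"
  assumes r: "Well_order r"
  obtains lt :: "'a \<Rightarrow> 'a \<Rightarrow> bool"
  where "\<And>a b. lt b a \<longleftrightarrow> b \<prec>\<^bsub>r\<^esub> a \<and> (\<forall>c. lt c b \<longrightarrow> f {c, b} = f {c, a})"
proof -
  define F where "F h b = {a. b \<prec>\<^bsub>r\<^esub> a \<and> (\<forall>c. c \<prec>\<^bsub>r\<^esub> b \<longrightarrow> b \<in> h c \<longrightarrow> f {c, b} = f {c, a})}"
    for h :: "'a \<Rightarrow> 'a set" and b
  \<comment> \<open>\<open>D b\<close> is the set of tree successors of \<open>b\<close>.\<close>
  define D where "D = wfrec (r - Id) F"
  have D: "D b = F D b" for b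
  proof -
    have "D b = F (cut D (r - Id) b) b"
      unfolding D_def by (rule wfrec[OF wf_prec[OF r]])
    also have "\<dots> = F D b"
      unfolding F_def prec_def by (simp add: cut_apply cong: conj_cong)
    finally show ?thesis .
  qed
  have DI: "a \<in> D b \<Longrightarrow> b \<prec>\<^bsub>r\<^esub> a" for a b
    using D[of b] unfolding F_def by blast
  have "a \<in> D b \<longleftrightarrow> b \<prec>\<^bsub>r\<^esub> a \<and> (\<forall>c. b \<in> D c \<longrightarrow> f {c, b} = f {c, a})" for a b
    using D[of b] DI unfolding F_def by blast
  then show thesis using that[of "\<lambda>b a. a \<in> D b"] by blast
qed

text \<open>
  The set \<open>E a\<close> of tree predecessors of \<open>a\<close> is a chain, and on it the colour of a pair depends only on
  the smaller element. The colour with \<open>a\<close> therefore splits \<open>E a\<close> into two homogeneous sets, and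
  \<open>|E a| < |M|\<close>. So the heights \<open>\<rho>\<close> can be taken in the well-order \<open>|M|\<close>, and \<open>a\<close>
  is determined by its height \<open>\<rho> a\<close> together with the set \<open>s a\<close> of the heights of those
  predecessors that have colour \<open>True\<close> with \<open>a\<close>: two distinct elements with the same
  predecessors and the same colours would be comparable in the tree.
\<close>

lemma end_homogeneous_codes:
  fixes f :: "'a set \<Rightarrow> bool" and M :: "'m set"
  assumes r: "Well_order r" and inf: "infinite M"
    and small: "\<And>T. T \<subseteq> Field r \<Longrightarrow> homogeneous f T \<Longrightarrow> |T| <o |M|"
  obtains \<rho> :: "'a \<Rightarrow> 'm" and s :: "'a \<Rightarrow> 'm set"
  where "\<And>a. \<rho> a \<in> M" "\<And>a. s a \<subseteq> underS |M| (\<rho> a)"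
    "inj_on (\<lambda>a. (\<rho> a, s a)) (Field r)"
proof -
  obtain lt :: "'a \<Rightarrow> 'a \<Rightarrow> bool" (infix "\<lhd>" 50)
    where lt: "\<And>a b. b \<lhd> a \<longleftrightarrow> b \<prec>\<^bsub>r\<^esub> a \<and> (\<forall>c. c \<lhd> b \<longrightarrow> f {c, b} = f {c, a})"
    using end_homogeneous_tree[OF r] by blast
  have lt_prec: "b \<prec>\<^bsub>r\<^esub> a" if "b \<lhd> a" for a b
    using lt[of b a] that by blast
  have lt_col: "f {c, b} = f {c, a}" if "c \<lhd> b" "b \<lhd> a" for a b c
    using lt[of b a] that by blast
  have trans: "c \<lhd> a" if "c \<lhd> b" "b \<lhd> a" for a b c
    using r that
  proof (induction c arbitrary: a b rule: prec_induct)
    case (less c)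
    have "f {d, c} = f {d, a}" if "d \<lhd> c" for d
      using less.IH[OF lt_prec[OF that] that less.prems(1)]
        lt_col[OF that less.prems(1)] lt_col[OF _ less.prems(2)] by blast
    then show ?case
      using lt[of c a] prec_trans[OF r] lt_prec less.prems by blast
  qed
  have chain: "b \<lhd> b'" if "b \<lhd> a" "b' \<lhd> a" "b \<prec>\<^bsub>r\<^esub> b'" for a b b'
    using r that
  proof (induction b rule: prec_induct)
    case (less b)
    have "f {d, b} = f {d, b'}" if d: "d \<lhd> b" for d
    proof -
      have "d \<lhd> b'"
        using less.IH[OF lt_prec[OF d] trans[OF d less.prems(1)] less.prems(2)]
          prec_trans[OF r lt_prec[OF d] less.prems(3)] by blast
      from lt_col[OF this less.prems(2)] lt_col[OF d less.prems(1)] show ?thesis by simp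
    qed
    then show ?case using lt[of b b'] less.prems(3) by blast
  qed
  define E where "E a = {c. c \<lhd> a}" for a
  have E_Field: "E a \<subseteq> Field r" for a
    unfolding E_def using prec_Field(1)[OF lt_prec] by auto
  have E_small: "|E a| <o |M|" for a
  proof -
    have hom: "homogeneous f {c\<in>E a. f {c, a} = i}" for i
      unfolding homogeneous_def
    proof (intro exI[of _ i] ballI impI)
      have *: "f {x, y} = i" if "x \<in> E a" "y \<in> E a" "f {x, a} = i" "x \<prec>\<^bsub>r\<^esub> y" for x y
        using chain[of x a y] lt_col[of x y a] that unfolding E_def by blast
      fix x y assume xy: "x \<in> {c\<in>E a. f {c, a} = i}" "y \<in> {c\<in>E a. f {c, a} = i}" "x \<noteq> y"
      have "x \<prec>\<^bsub>r\<^esub> y \<or> y \<prec>\<^bsub>r\<^esub> x"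
        using prec_total[OF r, of x y] xy E_Field by blast
      then show "f {x, y} = i"
      proof
        assume "x \<prec>\<^bsub>r\<^esub> y" then show ?thesis using * xy by blast
      next
        assume "y \<prec>\<^bsub>r\<^esub> x"
        then have "f {y, x} = i" using *[of y x] xy by blast
        then show ?thesis by (simp add: insert_commute)
      qed
    qed
    have "|{c\<in>E a. f {c, a} = i}| <o |M|" for i
      using small[OF _ hom] E_Field by blast
    then have "|{c\<in>E a. f {c, a} = True} \<union> {c\<in>E a. f {c, a} = False}| <o |M|"
      using card_of_Un_ordLess_infinite[OF inf] by blast
    moreover have "{c\<in>E a. f {c, a} = True} \<union> {c\<in>E a. f {c, a} = False} = E a" by blast
    ultimately show ?thesis by simp
  qed
  let ?W = "|M|"
  have W: "Well_order ?W" "Field ?W = M"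
    by (rule card_of_Well_order, rule Field_card_of)
  \<comment> \<open>The height of \<open>a\<close> is the least element of \<open>|M|\<close> that is not the height of a predecessor.\<close>
  define G where "G h a = wo_rel.minim ?W (M - h ` E a)" for h :: "'a \<Rightarrow> 'm" and a
  define \<rho> where "\<rho> = wfrec (r - Id) G"
  have \<rho>: "\<rho> a = wo_rel.minim ?W (M - \<rho> ` E a)" for a
  proof -
    have "\<rho> a = G (cut \<rho> (r - Id) a) a"
      unfolding \<rho>_def by (rule wfrec[OF wf_prec[OF r]])
    moreover have "cut \<rho> (r - Id) a ` E a = \<rho> ` E a"
      using lt_prec unfolding E_def prec_def by (intro image_cong) (auto simp: cut_apply)
    ultimately show ?thesis by (simp add: G_def)
  qed
  have wo: "wo_rel ?W" using W(1) by (simp add: wo_rel_def)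
  have ne: "M - \<rho> ` E a \<noteq> {}" for a
  proof
    assume "M - \<rho> ` E a = {}"
    then have "|M| \<le>o |E a|"
      using card_of_mono1[of M "\<rho> ` E a"] card_of_image[of \<rho> "E a"] ordLeq_transitive by blast
    then show False using E_small[of a] not_ordLess_ordLeq by blast
  qed
  have \<rho>_in: "\<rho> a \<in> M" "\<rho> a \<notin> \<rho> ` E a" for a
    using wo_rel.minim_in[OF wo, of "M - \<rho> ` E a"] ne[of a] W(2) \<rho>[of a] by auto
  have \<rho>_least: "i \<in> \<rho> ` E a" if "i \<prec>\<^bsub>?W\<^esub> \<rho> a" for i a
  proof (rule ccontr)
    assume "i \<notin> \<rho> ` E a"
    moreover have iM: "i \<in> M" using prec_Field(1)[OF that] W(2) by simp
    ultimately have "(\<rho> a, i) \<in> ?W"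
      using wo_rel.minim_least[OF wo, of "M - \<rho> ` E a" i] W(2) \<rho>[of a] by auto
    then have "\<rho> a \<prec>\<^bsub>?W\<^esub> i \<or> \<rho> a = i" unfolding prec_def by blast
    then show False using prec_asym[OF W(1) that] that by auto
  qed
  have \<rho>_mono: "\<rho> c \<prec>\<^bsub>?W\<^esub> \<rho> a" if "c \<lhd> a" for c a
  proof -
    have "\<not> \<rho> a \<prec>\<^bsub>?W\<^esub> \<rho> c"
    proof
      assume "\<rho> a \<prec>\<^bsub>?W\<^esub> \<rho> c"
      then obtain d where "d \<in> E c" "\<rho> a = \<rho> d" using \<rho>_least by blast
      then show False using \<rho>_in(2)[of a] trans[OF _ that] unfolding E_def by blast
    qed
    moreover have "\<rho> a \<noteq> \<rho> c"
      using \<rho>_in(2)[of a] that unfolding E_def by blast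
    ultimately show ?thesis
      using prec_total[OF W(1), of "\<rho> a" "\<rho> c"] \<rho>_in(1) W(2) by blast
  qed
  have level_inj: "c = c'" if c: "c \<lhd> a" "c' \<lhd> a" "\<rho> c = \<rho> c'" for a c c'
  proof (rule ccontr)
    assume "c \<noteq> c'"
    then have "c \<lhd> c' \<or> c' \<lhd> c"
      using prec_total[OF r, of c c'] chain c(1,2) E_Field[of a] unfolding E_def by blast
    then show False using \<rho>_mono[of c c'] \<rho>_mono[of c' c] c(3) by auto
  qed
  define s where "s a = \<rho> ` {c. c \<lhd> a \<and> f {c, a}}" for a
  have s_sub: "s a \<subseteq> underS ?W (\<rho> a)" for a
    unfolding s_def underS_prec using \<rho>_mono by blast
  \<comment> \<open>The code of a predecessor can be read off the code of \<open>a\<close>; this drives the induction on heights.\<close>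
  have s_restr: "s c = s a \<inter> underS ?W (\<rho> c)" if "c \<lhd> a" for c a
  proof
    show "s c \<subseteq> s a \<inter> underS ?W (\<rho> c)"
      using s_sub[of c] lt_col[OF _ that] trans[OF _ that] unfolding s_def by blast
  next
    show "s a \<inter> underS ?W (\<rho> c) \<subseteq> s c"
    proof
      fix i assume i: "i \<in> s a \<inter> underS ?W (\<rho> c)"
      then obtain d where d: "d \<lhd> a" "f {d, a}" "i = \<rho> d" unfolding s_def by blast
      from i obtain d' where d': "d' \<lhd> c" "i = \<rho> d'"
        using \<rho>_least[of i c] unfolding E_def underS_prec by blast
      then have "d = d'" using level_inj[of d a d'] trans[OF d'(1) that] d by simp
      then show "i \<in> s c" using d d' lt_col[of d c a] that unfolding s_def by blast
    qed
  qed
  have inj: "a = a'" if "a \<in> Field r" "a' \<in> Field r" "\<rho> a = \<rho> a'" "s a = s a'" for a a'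
    using W(1) that
  proof (induction "\<rho> a" arbitrary: a a' rule: prec_induct)
    case less
    have sub: "c \<lhd> y" if c: "c \<lhd> x" "\<rho> x = \<rho> y" "s x = s y" "\<rho> x = \<rho> a" for c x y
    proof -
      have *: "\<rho> c \<prec>\<^bsub>?W\<^esub> \<rho> y" using \<rho>_mono[OF c(1)] c(2) by simp
      then obtain c' where c': "c' \<lhd> y" "\<rho> c' = \<rho> c"
        using \<rho>_least[OF *] unfolding E_def by (elim imageE) simp
      have s_eq: "s c = s c'" by (simp only: s_restr[OF c(1)] s_restr[OF c'(1)] c'(2) c(3))
      have "\<rho> c \<prec>\<^bsub>?W\<^esub> \<rho> a" using * c by simp
      then have "c = c'"
        by (rule less.hyps[OF _ prec_Field(1)[OF lt_prec[OF c(1)]]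
              prec_Field(1)[OF lt_prec[OF c'(1)]] c'(2)[symmetric] s_eq])
      then show ?thesis using c'(1) by simp
    qed
    have E_eq: "c \<lhd> a \<longleftrightarrow> c \<lhd> a'" for c
      using sub[OF _ less.prems(3,4) refl] 
        sub[OF _ less.prems(3)[symmetric] less.prems(4)[symmetric] less.prems(3)[symmetric]] by (rule iffI)
    have col: "f {c, a} = f {c, a'}" if c: "c \<lhd> a" for c
    proof -
      have "f {c, x} \<longleftrightarrow> \<rho> c \<in> s x" if "c \<lhd> x" for x
        using level_inj[of _ x c] that unfolding s_def by (auto simp: image_iff)
      then show ?thesis using c E_eq less.prems(4) by blast
    qed
    show ?case
    proof (rule ccontr)
      assume "a \<noteq> a'"
      then have "a \<prec>\<^bsub>r\<^esub> a' \<or> a' \<prec>\<^bsub>r\<^esub> a"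
        using prec_total[OF r] less.prems by blast
      then have "a \<lhd> a' \<or> a' \<lhd> a"
        using lt[of a a'] lt[of a' a] col E_eq by metis
      then show False using E_eq lt_prec by (metis prec_irrefl)
    qed
  qed
  show thesis
    by (rule that[of \<rho> s]) (use \<rho>_in(1) s_sub inj in \<open>auto intro!: inj_onI\<close>)
qed

text \<open>
  Sort the elements by their height in the tree: a height \<open>i \<in> X n\<close> with at most \<open>|X n|\<close> heights
  below it admits at most \<open>|Pow (X n)|\<close> codes. Each height \<open>i\<close> is of this kind for some \<open>n\<close>,
  for otherwise all \<open>X n\<close>, and with them \<open>M\<close>, would have at most as many elements as
  the initial segment of \<open>|M|\<close> below \<open>i\<close>.
\<close>

lemma end_homogeneous_cover:
  fixes f :: "'a set \<Rightarrow> bool" and X :: "nat \<Rightarrow> 'm set"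
  assumes r: "Well_order r" and inf: "infinite M"
    and small: "\<And>T. T \<subseteq> Field r \<Longrightarrow> homogeneous f T \<Longrightarrow> |T| <o |M|"
    and X: "mono X" "M \<subseteq> (\<Union>n. X n)" "\<And>n. infinite (X n)"
  obtains K :: "nat \<Rightarrow> 'a set" where "Field r \<subseteq> (\<Union>n. K n)" "\<And>n. |K n| \<le>o |Pow (X n)|"
proof -
  obtain \<rho> :: "'a \<Rightarrow> 'm" and s :: "'a \<Rightarrow> 'm set"
    where \<rho>: "\<And>a. \<rho> a \<in> M" and s: "\<And>a. s a \<subseteq> underS |M| (\<rho> a)"
    and inj: "inj_on (\<lambda>a. (\<rho> a, s a)) (Field r)"
    using end_homogeneous_codes[OF r inf small] by blast
  define K where "K n = {a\<in>Field r. \<rho> a \<in> X n \<and> |underS |M| (\<rho> a)| \<le>o |X n|}" for n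
  have "|K n| \<le>o |Pow (X n)|" for n
  proof -
    let ?I = "{i\<in>X n. |underS |M| i| \<le>o |X n|}"
    have "(\<lambda>a. (\<rho> a, s a)) ` K n \<subseteq> (SIGMA i : ?I. Pow (underS |M| i))"
      using s unfolding K_def by auto
    moreover have "inj_on (\<lambda>a. (\<rho> a, s a)) (K n)"
      using inj by (rule inj_on_subset) (auto simp: K_def)
    ultimately have "|K n| \<le>o |SIGMA i : ?I. Pow (underS |M| i)|"
      using card_of_ordLeq by blast
    also have "|SIGMA i : ?I. Pow (underS |M| i)| \<le>o |Pow (X n)|"
    proof (rule card_of_Sigma_ordLeq_infinite)
      show "infinite (Pow (X n))" using X(3) by simp
      show "|?I| \<le>o |Pow (X n)|"
        using card_of_mono1[of ?I "X n"] ordLess_imp_ordLeq[OF card_of_Pow] ordLeq_transitive by blast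
      show "\<forall>i\<in>?I. |Pow (underS |M| i)| \<le>o |Pow (X n)|"
      proof
        fix i assume "i \<in> ?I"
        then have "|underS |M| i| \<le>o |X n|" by simp
        then obtain g where g: "inj_on g (underS |M| i)" "g ` underS |M| i \<subseteq> X n"
          unfolding card_of_ordLeq[symmetric] by auto
        then have "inj_on ((`) g) (Pow (underS |M| i))" "(`) g ` Pow (underS |M| i) \<subseteq> Pow (X n)"
          by (auto simp: inj_on_image_Pow)
        then show "|Pow (underS |M| i)| \<le>o |Pow (X n)|" using card_of_ordLeq by blast
      qed
    qed
    finally show ?thesis .
  qed
  moreover have "Field r \<subseteq> (\<Union>n. K n)"
  proof
    fix a assume a: "a \<in> Field r"
    let ?U = "underS |M| (\<rho> a)"
    obtain n where n: "\<rho> a \<in> X n" using \<rho> X(2) by blast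
    have U: "|?U| <o |M|"
      using card_of_underS[OF card_of_Card_order, of "\<rho> a" M] \<rho>[of a] by (simp add: Field_card_of)
    have "\<exists>m. |?U| \<le>o |X m|"
    proof (rule ccontr)
      assume "\<not> ?thesis"
      then have *: "|X m| \<le>o |?U|" for m
        using card_leq_or_less ordLess_imp_ordLeq by blast
      then have "infinite ?U" using X(3)[of 0] card_of_ordLeq_infinite by blast
      then have "|M| \<le>o |?U|" using countable_cover_leq[OF _ X(2) *] by blast
      then show False using U not_ordLess_ordLeq by blast
    qed
    then obtain m where m: "|?U| \<le>o |X m|" by blast
    have "X n \<subseteq> X (max m n)" "X m \<subseteq> X (max m n)"
      using monoD[OF X(1), of n "max m n"] monoD[OF X(1), of m "max m n"] by simp_all
    then have "\<rho> a \<in> X (max m n)" "|?U| \<le>o |X (max m n)|"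
      using n ordLeq_transitive[OF m card_of_mono1] by blast+
    then show "a \<in> (\<Union>n. K n)" using a unfolding K_def by blast
  qed
  ultimately show thesis using that by blast
qed

text \<open>
  The elements in question form an initial segment. Were it longer than \<open>|Y|\<close>, then \<open>|Y|\<close> would be
  isomorphic to the predecessors of one of its elements, which are fewer than \<open>|Y|\<close>.
\<close>

lemma card_of_small_initial_segments:
  assumes r: "Well_order r"
  shows "|{a\<in>Field r. |underS r a| <o |Y|}| \<le>o |Y|"
proof (rule ccontr)
  let ?J = "{a\<in>Field r. |underS r a| <o |Y|}"
  assume "\<not> ?thesis"
  then have "|Y| <o |?J|" using card_leq_or_less by blast
  let ?q = "Restr r ?J"
  have q: "Well_order ?q" using r by (rule Well_order_Restr)
  have F: "Field ?q = ?J"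
    using r by (intro Refl_Field_Restr2) (auto simp: order_on_defs)
  have "|?J| \<le>o ?q"
    using card_of_least[of ?J ?q] q F by simp
  then have "|Y| <o ?q" using \<open>|Y| <o |?J|\<close> ordLess_ordLeq_trans by blast
  then obtain a where a: "a \<in> ?J" "|Y| =o Restr ?q (underS ?q a)"
    using ordLess_iff_ordIso_Restr[OF q, of "|Y|"] F by (auto simp: card_of_Well_order)
  have "|Field |Y| | =o |Field (Restr ?q (underS ?q a))|"
    by (rule card_of_cong[OF a(2)])
  then have "|Y| \<le>o |Field (Restr ?q (underS ?q a))|"
    by (simp add: Field_card_of ordIso_imp_ordLeq)
  also have "|Field (Restr ?q (underS ?q a))| \<le>o |underS r a|"
    by (rule card_of_mono1) (auto simp: Field_def underS_def)
  finally show False using a(1) not_ordLess_ordLeq by blast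
qed

section \<open>Splitting a well-order into widely spaced sets\<close>

text \<open>
  Labels of this kind leave room: when two members of a family of blocks have minima with equal
  labels, any number of further members can be chosen between them, and also above both.
\<close>

definition spaced :: "'a rel \<Rightarrow> 'a set \<Rightarrow> ('a \<Rightarrow> nat) \<Rightarrow> bool" where
  "spaced r M h \<longleftrightarrow> (\<forall>x\<in>M. \<forall>y\<in>M. x \<prec>\<^bsub>r\<^esub> y \<longrightarrow> h x = h y \<longrightarrow>
    infinite {z\<in>M. x \<prec>\<^bsub>r\<^esub> z \<and> z \<prec>\<^bsub>r\<^esub> y} \<and> infinite {z\<in>M. y \<prec>\<^bsub>r\<^esub> z})"

text \<open>
  Write the position of \<open>x\<close> in \<open>M\<close> as zero or a limit ordinal, plus a finite \<open>pos x\<close>; the limit position is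
  held by \<open>lead x\<close>. Two elements with the same finite part belong to different limits, so
  infinitely many elements lie between them. The number \<open>tail x\<close> separates the elements above
  which only finitely many remain.
\<close>

lemma ex_spaced:
  assumes r: "Well_order r" and M: "M \<subseteq> Field r"
  shows "\<exists>h. spaced r M h"
proof -
  define seg where "seg a b = {z\<in>M. (z = a \<or> a \<prec>\<^bsub>r\<^esub> z) \<and> z \<prec>\<^bsub>r\<^esub> b}" for a b
  define above where "above a = {z\<in>M. a \<prec>\<^bsub>r\<^esub> z}" for a
  define A where "A x = {a\<in>M. (a = x \<or> a \<prec>\<^bsub>r\<^esub> x) \<and> finite (seg a x)}" for x
  have seg_self: "seg x x = {}" for x
    unfolding seg_def by (auto dest: prec_asym[OF r])
  have A_self: "x \<in> A x" if "x \<in> M" for x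
    using that seg_self[of x] unfolding A_def by simp
  have "\<forall>x\<in>M. \<exists>a. a \<in> A x \<and> (\<forall>b\<in>A x. b = a \<or> a \<prec>\<^bsub>r\<^esub> b)"
  proof
    fix x assume "x \<in> M"
    then have "A x \<subseteq> Field r" "A x \<noteq> {}" using A_self M unfolding A_def by blast+
    from least_element[OF r this] obtain a
      where "a \<in> A x" "\<And>b. b \<in> A x \<Longrightarrow> b = a \<or> a \<prec>\<^bsub>r\<^esub> b" by metis
    then show "\<exists>a. a \<in> A x \<and> (\<forall>b\<in>A x. b = a \<or> a \<prec>\<^bsub>r\<^esub> b)" by blast
  qed
  from bchoice[OF this] obtain lead where lead: "\<And>x. x \<in> M \<Longrightarrow> lead x \<in> A x"
    and lead_least: "\<And>x b. x \<in> M \<Longrightarrow> b \<in> A x \<Longrightarrow> b = lead x \<or> lead x \<prec>\<^bsub>r\<^esub> b" by blast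
  define pos where "pos x = card (seg (lead x) x)" for x
  \<comment> \<open>The successor keeps the last element, with nothing above it, apart from those with infinitely
      many elements above.\<close>
  define tail where "tail x = (if finite (above x) then Suc (card (above x)) else 0)" for x
  have above_inf: "infinite (above y)" if xy: "y \<in> M" "x \<prec>\<^bsub>r\<^esub> y" "tail x = tail y" for x y
  proof
    assume fin: "finite (above y)"
    then have "finite (above x)" "card (above x) = card (above y)"
      using xy(3) unfolding tail_def by (auto split: if_splits)
    moreover have "above y \<subset> above x"
    proof
      show "above y \<subseteq> above x"
        using prec_trans[OF r xy(2)] unfolding above_def by blast
      have "y \<in> above x" "y \<notin> above y"
        using xy unfolding above_def by auto
      then show "above y \<noteq> above x" by blast
    qed
    ultimately show False using psubset_card_mono by (metis less_irrefl)
  qed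
  have between_inf: "infinite {z\<in>M. x \<prec>\<^bsub>r\<^esub> z \<and> z \<prec>\<^bsub>r\<^esub> y}"
    if xy: "x \<in> M" "y \<in> M" "x \<prec>\<^bsub>r\<^esub> y" "pos x = pos y" for x y
  proof
    assume fin: "finite {z\<in>M. x \<prec>\<^bsub>r\<^esub> z \<and> z \<prec>\<^bsub>r\<^esub> y}"
    have "seg x y \<subseteq> insert x {z\<in>M. x \<prec>\<^bsub>r\<^esub> z \<and> z \<prec>\<^bsub>r\<^esub> y}" unfolding seg_def by auto
    then have seg_fin: "finite (seg x y)" using fin finite_subset by blast
    have lx: "lead x \<in> M" "lead x = x \<or> lead x \<prec>\<^bsub>r\<^esub> x" "finite (seg (lead x) x)"
      using lead[OF xy(1)] unfolding A_def by blast+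
    have ly: "lead y \<in> M" "finite (seg (lead y) y)"
      using lead[OF xy(2)] unfolding A_def by blast+
    have "seg (lead x) y \<subseteq> seg (lead x) x \<union> seg x y"
    proof
      fix z assume z: "z \<in> seg (lead x) y"
      then have "z \<prec>\<^bsub>r\<^esub> x \<or> z = x \<or> x \<prec>\<^bsub>r\<^esub> z"
        using prec_total[OF r, of z x] M xy(1) unfolding seg_def by blast
      then show "z \<in> seg (lead x) x \<union> seg x y" using z unfolding seg_def by auto
    qed
    then have fin_xy: "finite (seg (lead x) y)" using lx(3) seg_fin finite_subset by blast
    have "lead x \<prec>\<^bsub>r\<^esub> y" using lx(2) xy(3) prec_trans[OF r _ xy(3)] by metis
    then have "lead x \<in> A y" using lx(1) fin_xy unfolding A_def by simp
    then have 1: "lead x = lead y \<or> lead y \<prec>\<^bsub>r\<^esub> lead x" by (rule lead_least[OF xy(2)])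
    have "x \<in> A y" using xy(1,3) seg_fin unfolding A_def by simp
    then have "x = lead y \<or> lead y \<prec>\<^bsub>r\<^esub> x" by (rule lead_least[OF xy(2)])
    moreover have "seg (lead y) x \<subseteq> seg (lead y) y"
      using prec_trans[OF r _ xy(3)] unfolding seg_def by blast
    then have "finite (seg (lead y) x)" using ly(2) finite_subset by blast
    ultimately have "lead y \<in> A x" using ly(1) unfolding A_def by blast
    then have "lead y = lead x \<or> lead x \<prec>\<^bsub>r\<^esub> lead y" by (rule lead_least[OF xy(1)])
    then have eq: "lead x = lead y" using 1 prec_asym[OF r] by metis
    have "seg (lead x) x \<subset> seg (lead x) y"
    proof
      show "seg (lead x) x \<subseteq> seg (lead x) y"
        using prec_trans[OF r _ xy(3)] unfolding seg_def by blast
      have "x \<in> seg (lead x) y" "x \<notin> seg (lead x) x"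
        using lx(2) xy(1,3) unfolding seg_def by auto
      then show "seg (lead x) x \<noteq> seg (lead x) y" by blast
    qed
    then have "pos x < pos y"
      using psubset_card_mono[OF fin_xy] eq unfolding pos_def by simp
    then show False using xy(4) by simp
  qed
  have "spaced r M (\<lambda>x. prod_encode (pos x, tail x))"
    unfolding spaced_def using above_inf between_inf by (simp add: above_def prod_encode_eq)
  then show ?thesis by blast
qed

section \<open>Unmeshed families\<close>

lemma ord_min_props:
  assumes r: "Well_order r" and x: "x \<in> Fpow (Field r)" "x \<noteq> {}"
  shows "ord_min r x \<in> x" and "\<And>a. a \<in> x \<Longrightarrow> a = ord_min r x \<or> ord_min r x \<prec>\<^bsub>r\<^esub> a"
proof -
  have sub: "x \<subseteq> Field r" using x by (auto simp: Fpow_def)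
  obtain m where m: "m \<in> x" "\<And>b. b \<in> x \<Longrightarrow> b = m \<or> m \<prec>\<^bsub>r\<^esub> b"
    using least_element[OF r sub x(2)] by metis
  have refl: "(a, a) \<in> r" if "a \<in> x" for a
    using r sub that by (auto simp: order_on_defs refl_on_def)
  have "ord_min r x = m"
    unfolding ord_min_def
  proof (rule the_equality)
    show "m \<in> x \<and> (\<forall>a\<in>x. (m, a) \<in> r)"
      using m refl[OF m(1)] unfolding prec_def by blast
  next
    fix m' assume m': "m' \<in> x \<and> (\<forall>a\<in>x. (m', a) \<in> r)"
    show "m' = m"
    proof (rule ccontr)
      assume "m' \<noteq> m"
      then have "m \<prec>\<^bsub>r\<^esub> m'" "m' \<prec>\<^bsub>r\<^esub> m" using m m' unfolding prec_def by blast+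
      then show False using prec_asym[OF r] by blast
    qed
  qed
  then show "ord_min r x \<in> x" "\<And>a. a \<in> x \<Longrightarrow> a = ord_min r x \<or> ord_min r x \<prec>\<^bsub>r\<^esub> a"
    using m by auto
qed

lemma greatest_element:
  assumes r: "Well_order r" and "finite x" "x \<noteq> {}" "x \<subseteq> Field r"
  obtains m where "m \<in> x" "\<And>b. b \<in> x \<Longrightarrow> b = m \<or> b \<prec>\<^bsub>r\<^esub> m"
proof -
  have "\<exists>m\<in>x. \<forall>b\<in>x. b = m \<or> b \<prec>\<^bsub>r\<^esub> m"
    using assms(2-4)
  proof (induction x rule: finite_ne_induct)
    case (singleton x)
    then show ?case by simp
  next
    case (insert a F)
    then obtain m where m: "m \<in> F" "\<forall>b\<in>F. b = m \<or> b \<prec>\<^bsub>r\<^esub> m" by auto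
    have "a \<prec>\<^bsub>r\<^esub> m \<or> a = m \<or> m \<prec>\<^bsub>r\<^esub> a"
      using prec_total[OF r, of a m] insert.prems m(1) by blast
    then show ?case
    proof (elim disjE)
      assume "m \<prec>\<^bsub>r\<^esub> a"
      then have "\<forall>b\<in>insert a F. b = a \<or> b \<prec>\<^bsub>r\<^esub> a"
        using m(2) prec_trans[OF r _ \<open>m \<prec>\<^bsub>r\<^esub> a\<close>] by auto
      then show ?thesis by blast
    qed (use m in auto)
  qed
  then show thesis using that by blast
qed

lemma ord_max_props:
  assumes r: "Well_order r" and x: "x \<in> Fpow (Field r)" "x \<noteq> {}"
  shows "ord_max r x \<in> x" and "\<And>a. a \<in> x \<Longrightarrow> a = ord_max r x \<or> a \<prec>\<^bsub>r\<^esub> ord_max r x"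
proof -
  have sub: "x \<subseteq> Field r" "finite x" using x by (auto simp: Fpow_def)
  obtain m where m: "m \<in> x" "\<And>b. b \<in> x \<Longrightarrow> b = m \<or> b \<prec>\<^bsub>r\<^esub> m"
    using greatest_element[OF r sub(2) x(2) sub(1)] by metis
  have refl: "(a, a) \<in> r" if "a \<in> x" for a
    using r sub that by (auto simp: order_on_defs refl_on_def)
  have "ord_max r x = m"
    unfolding ord_max_def
  proof (rule the_equality)
    show "m \<in> x \<and> (\<forall>a\<in>x. (a, m) \<in> r)"
      using m refl[OF m(1)] unfolding prec_def by blast
  next
    fix m' assume m': "m' \<in> x \<and> (\<forall>a\<in>x. (a, m') \<in> r)"
    show "m' = m"
    proof (rule ccontr)
      assume "m' \<noteq> m"
      then have "m \<prec>\<^bsub>r\<^esub> m'" "m' \<prec>\<^bsub>r\<^esub> m" using m m' unfolding prec_def by blast+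
      then show False using prec_asym[OF r] by blast
    qed
  qed
  then show "ord_max r x \<in> x" "\<And>a. a \<in> x \<Longrightarrow> a = ord_max r x \<or> a \<prec>\<^bsub>r\<^esub> ord_max r x"
    using m by auto
qed

lemma unmeshed_familyD:
  assumes r: "Well_order r" and H: "unmeshed_family r H"
    and xy: "x \<in> H" "y \<in> H" "x \<noteq> y"
  shows "(\<forall>a\<in>x. \<forall>b\<in>y. a \<prec>\<^bsub>r\<^esub> b) \<or> (\<forall>a\<in>x. \<forall>b\<in>y. b \<prec>\<^bsub>r\<^esub> a)"
proof -
  have before: "\<forall>a\<in>u. \<forall>b\<in>v. a \<prec>\<^bsub>r\<^esub> b"
    if "u \<in> H" "v \<in> H" "ord_max r u \<prec>\<^bsub>r\<^esub> ord_min r v" for u v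
  proof (intro ballI)
    fix a b assume "a \<in> u" "b \<in> v"
    moreover have "u \<in> Fpow (Field r)" "u \<noteq> {}" "v \<in> Fpow (Field r)" "v \<noteq> {}"
      using H that(1,2) unfolding unmeshed_family_def by blast+
    ultimately have "a = ord_max r u \<or> a \<prec>\<^bsub>r\<^esub> ord_max r u" "b = ord_min r v \<or> ord_min r v \<prec>\<^bsub>r\<^esub> b"
      using ord_max_props(2)[OF r] ord_min_props(2)[OF r] by blast+
    then show "a \<prec>\<^bsub>r\<^esub> b" using that(3) prec_trans[OF r] by metis
  qed
  have "ord_max r x \<prec>\<^bsub>r\<^esub> ord_min r y \<or> ord_max r y \<prec>\<^bsub>r\<^esub> ord_min r x"
    using H xy unfolding unmeshed_family_def unmeshed_def prec_def by blast
  then show ?thesis using before[OF xy(1,2)] before[OF xy(2,1)] by blast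
qed

text \<open>
  The element of a set of size \<open>2 m\<close> that has position \<open>m + 1\<close>. In a set of odd size
  no element qualifies, and the value is arbitrary.
\<close>

definition middle :: "'a rel \<Rightarrow> 'a set \<Rightarrow> 'a" where
  "middle r U = (THE a. a \<in> U \<and> 2 * card {z\<in>U. z \<prec>\<^bsub>r\<^esub> a} = card U)"

lemma middle_eqI:
  assumes r: "Well_order r" and U: "U \<in> Fpow (Field r)"
    and a: "a \<in> U" "2 * card {z\<in>U. z \<prec>\<^bsub>r\<^esub> a} = card U"
  shows "middle r U = a"
  unfolding middle_def
proof (rule the_equality)
  have fin: "finite U" and sub: "U \<subseteq> Field r" using U by (auto simp: Fpow_def)
  fix b assume b: "b \<in> U \<and> 2 * card {z\<in>U. z \<prec>\<^bsub>r\<^esub> b} = card U"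
  have less: "card {z\<in>U. z \<prec>\<^bsub>r\<^esub> u} < card {z\<in>U. z \<prec>\<^bsub>r\<^esub> v}" if "u \<in> U" "u \<prec>\<^bsub>r\<^esub> v" for u v
  proof (rule psubset_card_mono)
    show "finite {z\<in>U. z \<prec>\<^bsub>r\<^esub> v}" using fin by simp
    show "{z\<in>U. z \<prec>\<^bsub>r\<^esub> u} \<subset> {z\<in>U. z \<prec>\<^bsub>r\<^esub> v}"
    proof
      show "{z\<in>U. z \<prec>\<^bsub>r\<^esub> u} \<subseteq> {z\<in>U. z \<prec>\<^bsub>r\<^esub> v}"
        using prec_trans[OF r _ that(2)] by blast
      have "u \<in> {z\<in>U. z \<prec>\<^bsub>r\<^esub> v}" "u \<notin> {z\<in>U. z \<prec>\<^bsub>r\<^esub> u}" using that by auto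
      then show "{z\<in>U. z \<prec>\<^bsub>r\<^esub> u} \<noteq> {z\<in>U. z \<prec>\<^bsub>r\<^esub> v}" by blast
    qed
  qed
  show "b = a"
    using prec_total[OF r, of a b] less[of a b] less[of b a] a b sub by auto
qed (use a in simp)

lemma finite_superset_of_card:
  assumes "infinite A" "finite B" "B \<subseteq> A" "card B \<le> k"
  obtains X where "B \<subseteq> X" "X \<subseteq> A" "finite X" "card X = k"
proof -
  have "infinite (A - B)" using assms(1,2) by simp
  then obtain C where C: "finite C" "card C = k - card B" "C \<subseteq> A - B"
    using infinite_arbitrarily_large by blast
  have "card (B \<union> C) = k"
    using C assms(2,4) by (subst card_Un_disjoint) auto
  then show thesis using that[of "B \<union> C"] C assms(2,3) by blast
qed

lemma FU_I: "X \<subseteq> H \<Longrightarrow> finite X \<Longrightarrow> card X \<in> A \<Longrightarrow> \<Union>X \<in> FU A H"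
  unfolding FU_def by blast

section \<open>Reading pairs off unions of evenly many blocks\<close>

text \<open>
  The hypothesis on \<open>\<kappa>\<close> is applied to the colouring \<open>c\<close> that gives colour \<open>2\<close> to sets whose minimum and
  maximum have different values of \<open>\<beta>\<close>, and otherwise the colour of the pair formed by the minimum
  and the middle. The resulting set \<open>M\<close> consists of the minima of the members of \<open>H\<close>,
  and \<open>h\<close> records the size of the member together with a spacing among the members of that size.
  Two minima \<open>x\<close> and \<open>y\<close> with the same value of \<open>h\<close> extend to \<open>b\<close> members of the same size, half of
  them below \<open>y\<close> and starting with \<open>x\<close>, so that \<open>x\<close> is the minimum and \<open>y\<close> the middle of their union.
\<close>

lemma homogeneous_pieces:
  fixes \<kappa> :: "'a rel" and l :: "'b rel" and \<beta> :: "'a \<Rightarrow> nat" and g :: "'a set \<Rightarrow> bool"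
  assumes \<kappa>: "Well_order \<kappa>" and uncountable: "|UNIV :: nat set| <o l"
    and FU: "\<And>c :: 'a set \<Rightarrow> nat. coloring 3 (Fpow (Field \<kappa>)) c \<Longrightarrow>
           \<exists>(H :: 'a set set) (b :: nat).
             unmeshed_family \<kappa> H \<and> |H| =o l \<and> even b \<and> b > 0 \<and> mono_under c (FU {b} H)"
    and \<beta>: "\<And>x y. x \<prec>\<^bsub>\<kappa>\<^esub> y \<Longrightarrow> \<beta> x \<le> \<beta> y"
  obtains M n h where "M \<subseteq> {a\<in>Field \<kappa>. \<beta> a = n}" "|M| =o l"
    "\<And>j :: nat. homogeneous g {a\<in>M. h a = j}"
proof -
  let ?min = "ord_min \<kappa>" and ?max = "ord_max \<kappa>"
  define c :: "'a set \<Rightarrow> nat" where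
    "c U = (if \<beta> (?min U) \<noteq> \<beta> (?max U) then 2 else if g {?min U, middle \<kappa> U} then 1 else 0)" for U
  have "coloring 3 (Fpow (Field \<kappa>)) c" by (auto simp: coloring_def c_def)
  from FU[OF this] obtain H b where H: "unmeshed_family \<kappa> H" "|H| =o l"
    and b: "even b" "b > 0" and mono: "mono_under c (FU {b} H)" by blast
  obtain i where i: "\<And>U. U \<in> FU {b} H \<Longrightarrow> c U = i" using mono unfolding mono_under_def by blast
  have uncH: "|UNIV :: nat set| <o |H|"
    using uncountable H(2) ordLess_ordIso_trans ordIso_symmetric by blast
  then have infH: "infinite H"
    using infinite_iff_card_of_nat ordLess_imp_ordLeq by blast
  have b2: "b \<ge> 2" using b by (metis One_nat_def Suc_1 Suc_leI le_neq_implies_less odd_one)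
  have HF: "x \<in> Fpow (Field \<kappa>)" "x \<noteq> {}" if "x \<in> H" for x
    using H(1) that unfolding unmeshed_family_def by blast+
  have UF: "\<Union>X \<in> Fpow (Field \<kappa>)" if "X \<subseteq> H" "finite X" for X
    using that HF unfolding Fpow_def by blast
  have \<beta>': "\<beta> (?min x) \<le> \<beta> a" "\<beta> a \<le> \<beta> (?max x)" if "x \<in> Fpow (Field \<kappa>)" "a \<in> x" for x a
  proof -
    have "a = ?min x \<or> ?min x \<prec>\<^bsub>\<kappa>\<^esub> a" "a = ?max x \<or> a \<prec>\<^bsub>\<kappa>\<^esub> ?max x"
      using ord_min_props(2)[OF \<kappa>, of x a] ord_max_props(2)[OF \<kappa>, of x a] that by blast+
    then show "\<beta> (?min x) \<le> \<beta> a" "\<beta> a \<le> \<beta> (?max x)" using \<beta> by auto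
  qed
  have minH: "?min x \<in> x" "?max x \<in> x" if "x \<in> H" for x
    using ord_min_props(1)[OF \<kappa>] ord_max_props(1)[OF \<kappa>] HF that by blast+

  \<comment> \<open>Colour \<open>2\<close> is impossible: infinitely many members of \<open>H\<close> have the same values \<open>u\<close> and \<open>v\<close> of \<open>\<beta>\<close> at
      their minimum and maximum, and for two of them \<open>u \<le> v \<le> u\<close>.\<close>
  have same_block: "\<beta> (?min (\<Union>X)) = \<beta> (?max (\<Union>X))" if X: "X \<subseteq> H" "finite X" "card X = b" for X
  proof -
    have "i \<noteq> 2"
    proof
      assume i2: "i = 2"
      let ?code = "\<lambda>x. prod_encode (\<beta> (?min x), \<beta> (?max x))"
      have "\<exists>m. infinite {x\<in>H. ?code x = m}"
      proof (rule ccontr)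
        assume "\<not> ?thesis"
        then have fin: "finite {x\<in>H. ?code x = m}" for m by blast
        have "|{x\<in>H. ?code x = m}| \<le>o |UNIV :: nat set|" for m
          using card_leq_or_less[of "{x\<in>H. ?code x = m}" "UNIV :: nat set"] fin[of m]
            infinite_iff_card_of_nat ordLess_imp_ordLeq by blast
        then have "|H| \<le>o |UNIV :: nat set|"
          using countable_cover_leq[of "UNIV :: nat set" H "\<lambda>m. {x\<in>H. ?code x = m}"] by blast
        then show False using uncH not_ordLess_ordLeq by blast
      qed
      then obtain m where m: "infinite {x\<in>H. ?code x = m}" by blast
      let ?G = "{x\<in>H. ?code x = m}"
      obtain u v where "prod_decode m = (u, v)" by fastforce
      then have uv: "\<beta> (?min x) = u" "\<beta> (?max x) = v" if "x \<in> ?G" for x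
        using that prod_encode_inverse[of "(\<beta> (?min x), \<beta> (?max x))"] by auto
      obtain Y where Y: "finite Y" "card Y = b" "Y \<subseteq> ?G"
        using infinite_arbitrarily_large[OF m] by blast
      have YH: "Y \<subseteq> H" using Y(3) by blast
      have uvY: "\<beta> (?min x) = u" "\<beta> (?max x) = v" if "x \<in> Y" for x
        by (rule uv[OF subsetD[OF Y(3) that]])+
      obtain x y where xy: "x \<in> Y" "y \<in> Y" "x \<noteq> y"
        using b2 Y(2) by (metis card_le_Suc0_iff_eq Y(1) not_less_eq_eq numeral_2_eq_2)
      have vu: "v \<le> u" if "x \<in> Y" "y \<in> Y" "\<forall>a\<in>x. \<forall>b\<in>y. a \<prec>\<^bsub>\<kappa>\<^esub> b" for x y
      proof -
        have "?max x \<prec>\<^bsub>\<kappa>\<^esub> ?min y"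
          using minH(2)[of x] minH(1)[of y] that YH by blast
        from \<beta>[OF this] show ?thesis using uvY(2)[OF that(1)] uvY(1)[OF that(2)] by simp
      qed
      have "v \<le> u"
        using unmeshed_familyD[OF \<kappa> H(1), of x y] vu[of x y] vu[of y x] xy YH by blast
      moreover have "u \<le> v"
        using \<beta>'(1)[OF HF(1) minH(2), of x] uvY[OF xy(1)] subsetD[OF YH xy(1)] by simp
      ultimately have \<open>u = v\<close> by simp
      have U: "\<Union>Y \<in> Fpow (Field \<kappa>)" "\<Union>Y \<noteq> {}"
        using UF[of Y] YH Y(1) xy(1) HF(2)[of x] by blast+
      have "\<beta> a = u" if a: "a \<in> \<Union>Y" for a
      proof -
        obtain z where z: "z \<in> Y" "a \<in> z" using a by blast
        then have "z \<in> H" using YH by blast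
        from \<beta>'[OF HF(1)[OF this] z(2)] show ?thesis using uvY[OF z(1)] \<open>u = v\<close> by simp
      qed
      then have "\<beta> (?min (\<Union>Y)) = \<beta> (?max (\<Union>Y))"
        using ord_min_props(1)[OF \<kappa> U] ord_max_props(1)[OF \<kappa> U] by simp
      moreover have "c (\<Union>Y) = 2" using i[OF FU_I[OF YH Y(1)]] Y(2) i2 by simp
      ultimately show False by (auto simp: c_def split: if_splits)
    qed
    moreover have "c (\<Union>X) = i" using i[OF FU_I[OF X(1,2)]] X(3) by simp
    ultimately show ?thesis by (auto simp: c_def split: if_splits)
  qed

  \<comment> \<open>Any two members of \<open>H\<close> are part of a union of \<open>b\<close> members, on which \<open>\<beta>\<close> is constant.\<close>
  have block: "\<beta> (?min x) = \<beta> (?min y)" if xy: "x \<in> H" "y \<in> H" for x y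
  proof -
    have "card {x, y} \<le> b" using b2 by (cases "x = y") auto
    then obtain X where X: "{x, y} \<subseteq> X" "X \<subseteq> H" "finite X" "card X = b"
      using finite_superset_of_card[OF infH, of "{x, y}" b] xy by auto
    have *: "\<beta> a = \<beta> (?min (\<Union>X))" if "a \<in> \<Union>X" for a
      using \<beta>'[OF UF[OF X(2,3)] that] same_block[OF X(2-4)] by simp
    have "?min x \<in> \<Union>X" "?min y \<in> \<Union>X"
      using minH(1)[OF xy(1)] minH(1)[OF xy(2)] X(1) by blast+
    from *[OF this(1)] *[OF this(2)] show ?thesis by simp
  qed

  have inj: "inj_on ?min H"
  proof (rule inj_onI)
    fix x y assume xy: "x \<in> H" "y \<in> H" "?min x = ?min y"
    show "x = y"
      using unmeshed_familyD[OF \<kappa> H(1) xy(1,2)] minH(1)[OF xy(1)] minH(1)[OF xy(2)] xy(3)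
        prec_irrefl[of "?min x" \<kappa>] by metis
  qed
  \<comment> \<open>From here on, a member of \<open>H\<close> is represented by its minimum \<open>a\<close> and recovered as \<open>S a\<close>.\<close>
  define M where "M = ?min ` H"
  define S where "S = the_inv_into H ?min"
  have S: "S a \<in> H" "?min (S a) = a" if "a \<in> M" for a
    using that inj unfolding M_def S_def by (auto simp: the_inv_into_into the_inv_into_f_f f_the_inv_into_f)
  have a_S: "a \<in> S a" if "a \<in> M" for a
    using minH(1)[OF S(1)[OF that]] S(2)[OF that] by simp
  have MF: "M \<subseteq> Field \<kappa>"
    using S(1) a_S HF(1) unfolding Fpow_def by blast
  have S_before: "a' \<prec>\<^bsub>\<kappa>\<^esub> b'" if "a \<in> M" "b \<in> M" "a \<prec>\<^bsub>\<kappa>\<^esub> b" "a' \<in> S a" "b' \<in> S b" for a b a' b'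
  proof -
    have "S a \<noteq> S b" using S(2) that by (metis prec_irrefl)
    then show ?thesis
      using unmeshed_familyD[OF \<kappa> H(1) S(1)[OF that(1)] S(1)[OF that(2)]] that
        a_S[OF that(1)] a_S[OF that(2)] prec_asym[OF \<kappa> that(3)] by blast
  qed
  have S_disj: "S a \<inter> S b = {}" if "a \<in> M" "b \<in> M" "a \<noteq> b" for a b
  proof -
    have "a \<prec>\<^bsub>\<kappa>\<^esub> b \<or> b \<prec>\<^bsub>\<kappa>\<^esub> a" using prec_total[OF \<kappa>, of a b] that MF by blast
    then show ?thesis
      using S_before[of a b] S_before[of b a] that(1,2) prec_irrefl[of _ \<kappa>] by blast
  qed
  have finS: "finite (S a)" if "a \<in> M" for a
    using HF(1)[OF S(1)[OF that]] unfolding Fpow_def by blast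
  have "\<exists>h. spaced \<kappa> {a\<in>M. card (S a) = k} h" for k
    using ex_spaced[OF \<kappa>] MF by (metis (no_types, lifting) mem_Collect_eq subset_iff)
  then obtain hk where hk: "\<And>k. spaced \<kappa> {a\<in>M. card (S a) = k} (hk k)" by metis
  define h where "h a = prod_encode (card (S a), hk (card (S a)) a)" for a

  have pair: "g {x, y} \<longleftrightarrow> i = 1"
    if xy: "x \<in> M" "y \<in> M" "x \<prec>\<^bsub>\<kappa>\<^esub> y" "h x = h y" for x y
  proof -
    define k where "k = card (S x)"
    let ?Mk = "{a\<in>M. card (S a) = k}"
    have k: "card (S x) = k" "card (S y) = k" "hk k x = hk k y"
      using xy(4) unfolding h_def k_def by (auto simp: prod_encode_eq)
    have inf: "infinite {z\<in>?Mk. x \<prec>\<^bsub>\<kappa>\<^esub> z \<and> z \<prec>\<^bsub>\<kappa>\<^esub> y}" "infinite {z\<in>?Mk. y \<prec>\<^bsub>\<kappa>\<^esub> z}"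
      using hk[of k] xy(1-3) k unfolding spaced_def by blast+
    obtain q where q: "b = 2 * Suc q" using b by (metis dvd_def gr0_implies_Suc mult_0_right neq0_conv)
    obtain P where P: "finite P" "card P = q" "P \<subseteq> {z\<in>?Mk. x \<prec>\<^bsub>\<kappa>\<^esub> z \<and> z \<prec>\<^bsub>\<kappa>\<^esub> y}"
      using infinite_arbitrarily_large[OF inf(1)] by blast
    obtain Q where Q: "finite Q" "card Q = q" "Q \<subseteq> {z\<in>?Mk. y \<prec>\<^bsub>\<kappa>\<^esub> z}"
      using infinite_arbitrarily_large[OF inf(2)] by blast
    \<comment> \<open>The lower half of the union starts with \<open>x\<close>, the upper half with \<open>y\<close>.\<close>
    let ?L = "insert x P" and ?R = "insert y Q"
    have "x \<notin> P" "y \<notin> Q" using P(3) Q(3) by auto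
    then have L: "finite ?L" "card ?L = Suc q" "?L \<subseteq> ?Mk"
      using P xy k by auto
    from \<open>y \<notin> Q\<close> have R: "finite ?R" "card ?R = Suc q" "?R \<subseteq> ?Mk"
      using Q xy k by auto
    have L_y: "a \<prec>\<^bsub>\<kappa>\<^esub> y" if "a \<in> ?L" for a using that P(3) xy(3) by blast
    have R_y: "a = y \<or> y \<prec>\<^bsub>\<kappa>\<^esub> a" if "a \<in> ?R" for a using that Q(3) by blast
    have LR: "?L \<inter> ?R = {}" using L_y R_y prec_asym[OF \<kappa>] by (metis disjoint_iff prec_irrefl)
    define U where "U = \<Union>(S ` (?L \<union> ?R))"
    have cardS: "card (\<Union>(S ` W)) = card W * k" if "finite W" "W \<subseteq> ?Mk" for W
    proof -
      have "card (\<Union>a\<in>W. S a) = (\<Sum>a\<in>W. card (S a))"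
        using that finS S_disj by (intro card_UN_disjoint) blast+
      also have "\<dots> = card W * k" using that(2) by (simp add: subset_iff)
      finally show ?thesis .
    qed
    have cardLR: "card (?L \<union> ?R) = b"
      using card_Un_disjoint[OF L(1) R(1) LR] L(2) R(2) q by simp
    have cardU: "card U = b * k"
      unfolding U_def cardLR[symmetric] by (rule cardS) (rule finite_UnI[OF L(1) R(1)], rule Un_least[OF L(3) R(3)])
    have injS: "inj_on S M" using S(2) by (metis inj_onI)
    have X: "S ` (?L \<union> ?R) \<subseteq> H" "finite (S ` (?L \<union> ?R))" "card (S ` (?L \<union> ?R)) = b"
    proof -
      show "S ` (?L \<union> ?R) \<subseteq> H" using S(1) L(3) R(3) by blast
      show "finite (S ` (?L \<union> ?R))" using L(1) R(1) by blast
      have "card (S ` (?L \<union> ?R)) = card (?L \<union> ?R)"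
        using injS L(3) R(3) by (intro card_image inj_on_subset[OF injS]) blast
      then show "card (S ` (?L \<union> ?R)) = b" by (simp only: cardLR)
    qed
    have U: "U \<in> Fpow (Field \<kappa>)" unfolding U_def by (rule UF[OF X(1,2)])
    have xU: "x \<in> U" and yU: "y \<in> U" unfolding U_def using a_S xy(1,2) by blast+
    have "?min U = x"
    proof -
      have x_least: "z = x \<or> x \<prec>\<^bsub>\<kappa>\<^esub> z" if z: "z \<in> U" for z
      proof -
        obtain a where a: "a \<in> ?L \<union> ?R" "z \<in> S a" using z unfolding U_def by blast
        have aM: "a \<in> M" using a(1) L(3) R(3) by blast
        have "a = x \<or> x \<prec>\<^bsub>\<kappa>\<^esub> a" using a(1) P(3) R_y xy(3) prec_trans[OF \<kappa> xy(3)] by blast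
        then show ?thesis
        proof
          assume "a = x"
          then show ?thesis
            using ord_min_props(2)[OF \<kappa> HF[OF S(1)[OF xy(1)]], of z] S(2)[OF xy(1)] a(2) by simp
        next
          assume "x \<prec>\<^bsub>\<kappa>\<^esub> a"
          then show ?thesis using S_before[OF xy(1) aM _ a_S[OF xy(1)] a(2)] by blast
        qed
      qed
      have "U \<noteq> {}" using xU by blast
      from ord_min_props[OF \<kappa> U this] show ?thesis
        using x_least xU prec_asym[OF \<kappa>] by metis
    qed
    moreover have "middle \<kappa> U = y"
    proof (rule middle_eqI[OF \<kappa> U yU])
      have "{z\<in>U. z \<prec>\<^bsub>\<kappa>\<^esub> y} = \<Union>(S ` ?L)"
      proof
        show "\<Union>(S ` ?L) \<subseteq> {z\<in>U. z \<prec>\<^bsub>\<kappa>\<^esub> y}"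
          using S_before[OF _ xy(2) L_y _ a_S[OF xy(2)]] L(3) unfolding U_def by blast
      next
        have "\<not> z \<prec>\<^bsub>\<kappa>\<^esub> y" if a: "a \<in> ?R" "z \<in> S a" for a z
        proof -
          have "z = y \<or> y \<prec>\<^bsub>\<kappa>\<^esub> z"
          proof (cases "a = y")
            case True
            then show ?thesis
              using ord_min_props(2)[OF \<kappa> HF[OF S(1)[OF xy(2)]], of z] S(2)[OF xy(2)] a(2) by simp
          next
            case False
            then show ?thesis
              using S_before[OF xy(2) _ _ a_S[OF xy(2)] a(2)] R_y[OF a(1)] R(3) a(1) by blast
          qed
          then show ?thesis using prec_asym[OF \<kappa>] prec_irrefl by metis
        qed
        then show "{z\<in>U. z \<prec>\<^bsub>\<kappa>\<^esub> y} \<subseteq> \<Union>(S ` ?L)" unfolding U_def by blast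
      qed
      then have "card {z\<in>U. z \<prec>\<^bsub>\<kappa>\<^esub> y} = Suc q * k" using cardS[OF L(1,3)] L(2) by simp
      then show "2 * card {z\<in>U. z \<prec>\<^bsub>\<kappa>\<^esub> y} = card U" using cardU q by simp
    qed
    moreover have "\<beta> (?min U) = \<beta> (?max U)" unfolding U_def by (rule same_block[OF X])
    moreover have "c U = i" unfolding U_def by (rule i[OF FU_I[OF X(1,2)]]) (simp only: X(3) singleton_iff)
    ultimately show ?thesis by (auto simp: c_def split: if_splits)
  qed

  have "homogeneous g {a\<in>M. h a = j}" for j
    unfolding homogeneous_def
  proof (intro exI[of _ "i = 1"] ballI impI)
    fix x y assume xy: "x \<in> {a\<in>M. h a = j}" "y \<in> {a\<in>M. h a = j}" "x \<noteq> y"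
    then have "x \<prec>\<^bsub>\<kappa>\<^esub> y \<or> y \<prec>\<^bsub>\<kappa>\<^esub> x"
      using prec_total[OF \<kappa>, of x y] MF by blast
    then show "g {x, y} = (i = 1)"
      using pair[of x y] pair[of y x] xy by (auto simp: insert_commute)
  qed
  moreover have "|M| =o l"
  proof -
    have "|H| =o |M|"
      unfolding M_def using inj by (meson card_of_ordIso inj_on_imp_bij_betw)
    then show ?thesis using H(2) ordIso_symmetric ordIso_transitive by blast
  qed
  moreover obtain x0 where x0: "x0 \<in> H" using infH by (metis finite.emptyI all_not_in_conv)
  have "\<beta> a = \<beta> (?min x0)" if "a \<in> M" for a
    using block[OF _ x0] that unfolding M_def by blast
  then have "M \<subseteq> {a\<in>Field \<kappa>. \<beta> a = \<beta> (?min x0)}" using MF by blast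
  ultimately show thesis using that by blast
qed

section \<open>The partition relation\<close>

lemma homogeneous_imp_mono_under:
  assumes f: "coloring 2 ([A]\<^bsup>2\<^esup>) f" and T: "T \<subseteq> A" "homogeneous (\<lambda>p. f p = 1) T"
  shows "mono_under f ([T]\<^bsup>2\<^esup>)"
proof -
  obtain i where i: "\<And>x y. x \<in> T \<Longrightarrow> y \<in> T \<Longrightarrow> x \<noteq> y \<Longrightarrow> (f {x, y} = 1) = i"
    using T(2) unfolding homogeneous_def by (elim exE) simp
  have "f p = (if i then 1 else 0)" if p: "p \<in> [T]\<^bsup>2\<^esup>" for p
  proof -
    obtain x y where xy: "p = {x, y}" "x \<in> T" "y \<in> T" "x \<noteq> y" using p by (rule nsets2_E)
    have "f {x, y} < 2"
      using f xy T(1) unfolding coloring_def Pi_iff by (metis doubleton_in_nsets_2 lessThan_iff subsetD)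
    then show ?thesis using i[OF xy(2-4)] xy(1) by auto
  qed
  then show ?thesis unfolding mono_under_def by blast
qed

lemma subset_of_cardinality:
  assumes l: "Card_order l" and le: "l \<le>o |Y|"
  obtains T where "T \<subseteq> Y" "|T| =o l"
proof -
  have Fl: "|Field l| =o l" by (rule card_of_Field_ordIso[OF l])
  have "|Field l| \<le>o |Y|" using Fl le by (rule ordIso_ordLeq_trans)
  then obtain T where T: "T \<subseteq> Y" "|Field l| =o |T|"
    unfolding internalize_card_of_ordLeq2[of "Field l" Y] by blast
  have "|T| =o l" using ordIso_symmetric[OF T(2)] Fl by (rule ordIso_transitive)
  with T(1) show thesis by (rule that)
qed

lemma countable_arrows:
  assumes l: "Card_order l" and le: "l \<le>o |UNIV :: nat set|"
    and S: "infinite S" and f: "coloring 2 ([S]\<^bsup>2\<^esup>) f"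
  shows "\<exists>T\<subseteq>S. |T| =o l \<and> mono_under f ([T]\<^bsup>2\<^esup>)"
proof -
  have "\<forall>X. X \<subseteq> S \<and> finite X \<and> card X = 2 \<longrightarrow> f X < 2"
    using f unfolding coloring_def Pi_iff nsets_def by auto
  from Ramsey[OF S this] obtain Y t where Y: "Y \<subseteq> S" "infinite Y"
    "\<forall>X. X \<subseteq> Y \<and> finite X \<and> card X = 2 \<longrightarrow> f X = t" by metis
  have "l \<le>o |Y|"
    using le Y(2)[unfolded infinite_iff_card_of_nat] by (rule ordLeq_transitive)
  then obtain T where T: "T \<subseteq> Y" "|T| =o l"
    by (rule subset_of_cardinality[OF l])
  moreover have "mono_under f ([T]\<^bsup>2\<^esup>)"
    unfolding mono_under_def
  proof (intro exI[of _ t] ballI)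
    fix p assume "p \<in> [T]\<^bsup>2\<^esup>"
    then show "f p = t" using Y(3) T(1) by (auto simp: nsets_def)
  qed
  ultimately show ?thesis using Y(1) by blast
qed

text \<open>
  The heart of the matter: the cover of \<open>M\<close> by the sets \<open>X n\<close> comes from a first application of the
  hypothesis to \<open>f\<close>, the intervals and their Sierpinski colourings from the sets \<open>X n\<close>, and the
  contradiction from a second application to these colourings.
\<close>

lemma no_uncountable_counterexample:
  fixes \<kappa> :: "'a rel" and l :: "'b rel" and f :: "'a set \<Rightarrow> bool"
  assumes l: "Card_order l" and uncountable: "|UNIV :: nat set| <o l" and \<kappa>: "Card_order \<kappa>"
    and FU: "\<And>c :: 'a set \<Rightarrow> nat. coloring 3 (Fpow (Field \<kappa>)) c \<Longrightarrow>
           \<exists>(H :: 'a set set) (b :: nat).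
             unmeshed_family \<kappa> H \<and> |H| =o l \<and> even b \<and> b > 0 \<and> mono_under c (FU {b} H)"
    and small: "\<And>T. T \<subseteq> Field \<kappa> \<Longrightarrow> homogeneous f T \<Longrightarrow> |T| <o l"
  shows False
proof -
  have W: "Well_order \<kappa>" using \<kappa> by (simp add: card_order_on_def)
  obtain M n0 h where M: "M \<subseteq> {a\<in>Field \<kappa>. (0 :: nat) = n0}" "|M| =o l"
    and h: "\<And>j :: nat. homogeneous f {a\<in>M. h a = j}"
    by (rule homogeneous_pieces[OF W uncountable FU, where \<beta> = "\<lambda>_. 0" and g = f]) auto
  have lM: "l =o |M|" using M(2) by (rule ordIso_symmetric)
  have uncM: "|UNIV :: nat set| <o |M|" using uncountable lM by (rule ordLess_ordIso_trans)
  then have infM: "infinite M" using infinite_iff_card_of_nat ordLess_imp_ordLeq by blast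
  have smallM: "|T| <o |M|" if "T \<subseteq> Field \<kappa>" "homogeneous f T" for T
    using small[OF that] lM by (rule ordLess_ordIso_trans)
  have fibre: "|{a\<in>M. h a = j}| <o |M|" for j
    using smallM[OF _ h] M(1) by blast
  obtain e :: "nat \<Rightarrow> 'a" where e: "inj e" "range e \<subseteq> M"
    using infM by (meson infinite_iff_countable_subset)
  \<comment> \<open>The countable set \<open>range e\<close> makes the sets infinite; as \<open>|M|\<close> is uncountable, they stay small.\<close>
  define X where "X n = range e \<union> {a\<in>M. h a \<le> n}" for n
  have X_small: "|X n| <o |M|" for n
  proof (induction n)
    case 0
    have "|range e| <o |M|" using card_of_image uncM by (rule ordLeq_ordLess_trans)
    from card_of_Un_ordLess_infinite[OF infM this fibre[of 0]]
    show ?case by (simp add: X_def)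
  next
    case (Suc n)
    have "X (Suc n) = X n \<union> {a\<in>M. h a = Suc n}" by (auto simp: X_def)
    then show ?case using card_of_Un_ordLess_infinite[OF infM Suc fibre[of "Suc n"]] by simp
  qed
  have X: "mono X" "M \<subseteq> (\<Union>n. X n)"
    unfolding X_def by (auto simp: mono_def)
  have X_inf: "infinite (X n)" for n
    using range_inj_infinite[OF e(1)] by (simp add: X_def)
  obtain K :: "nat \<Rightarrow> 'a set" where K: "Field \<kappa> \<subseteq> (\<Union>n. K n)" "\<And>n. |K n| \<le>o |Pow (X n)|"
    using end_homogeneous_cover[OF W infM smallM X X_inf] by metis

  define J where "J n = {a\<in>Field \<kappa>. |underS \<kappa> a| <o |Pow (X n)|}" for n
  have J_card: "|J n| \<le>o |Pow (X n)|" for n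
    unfolding J_def by (rule card_of_small_initial_segments[OF W])
  \<comment> \<open>Otherwise a proper initial segment of \<open>\<kappa>\<close> would be at least as large as each set of
      the countable cover \<open>K\<close>, hence as large as \<open>\<kappa>\<close>.\<close>
  have J_ex: "\<exists>n. a \<in> J n" if a: "a \<in> Field \<kappa>" for a
  proof (rule ccontr)
    assume "\<not> ?thesis"
    then have *: "|Pow (X n)| \<le>o |underS \<kappa> a|" for n
      using card_leq_or_less a unfolding J_def by blast
    have "infinite (underS \<kappa> a)"
      using card_of_ordLeq_infinite[OF *[of 0]] X_inf[of 0] by simp
    then have "|Field \<kappa>| \<le>o |underS \<kappa> a|"
      using countable_cover_leq[OF _ K(1)] ordLeq_transitive[OF K(2) *] by blast
    moreover have "|underS \<kappa> a| <o |Field \<kappa>|"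
      using card_of_underS[OF \<kappa> a] ordIso_symmetric[OF card_of_Field_ordIso[OF \<kappa>]]
      by (rule ordLess_ordIso_trans)
    ultimately show False using not_ordLess_ordLeq by blast
  qed
  define \<beta> where "\<beta> a = (LEAST n. a \<in> J n)" for a
  have J_\<beta>: "a \<in> J (\<beta> a)" if "a \<in> Field \<kappa>" for a
    unfolding \<beta>_def using J_ex[OF that] by (rule LeastI_ex)
  have \<beta>_mono: "\<beta> x \<le> \<beta> y" if xy: "x \<prec>\<^bsub>\<kappa>\<^esub> y" for x y
  proof -
    have "|underS \<kappa> x| \<le>o |underS \<kappa> y|"
      by (rule card_of_mono1) (use prec_trans[OF W _ xy] in \<open>auto simp: underS_prec\<close>)
    moreover have "|underS \<kappa> y| <o |Pow (X (\<beta> y))|"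
      using J_\<beta>[OF prec_Field(2)[OF xy]] unfolding J_def by simp
    ultimately have "x \<in> J (\<beta> y)"
      using prec_Field(1)[OF xy] ordLeq_ordLess_trans unfolding J_def by blast
    then show ?thesis unfolding \<beta>_def[of x] by (rule Least_le)
  qed

  have "\<exists>g :: 'a set \<Rightarrow> bool. \<forall>T. T \<subseteq> J n \<longrightarrow> homogeneous g T \<longrightarrow> |T| \<le>o |X n|" for n
  proof -
    have "J n \<subseteq> Field \<kappa>" by (auto simp: J_def)
    from sierpinski[OF W this X_inf J_card] show ?thesis by metis
  qed
  then obtain gs :: "nat \<Rightarrow> 'a set \<Rightarrow> bool"
    where gs: "\<And>n T. T \<subseteq> J n \<Longrightarrow> homogeneous (gs n) T \<Longrightarrow> |T| \<le>o |X n|" by metis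
  \<comment> \<open>On a pair inside one interval, \<open>\<beta>\<close> takes a single value, the index of that interval.\<close>
  define g where "g p = gs (Min (\<beta> ` p)) p" for p
  obtain M' n h' where M': "M' \<subseteq> {a\<in>Field \<kappa>. \<beta> a = n}" "|M'| =o l"
    and h': "\<And>j :: nat. homogeneous g {a\<in>M'. h' a = j}"
    by (rule homogeneous_pieces[OF W uncountable FU \<beta>_mono, where g = g]) auto
  have "|{a\<in>M'. h' a = j}| \<le>o |X n|" for j
  proof (rule gs)
    show "{a\<in>M'. h' a = j} \<subseteq> J n" using M'(1) J_\<beta> by blast
    have "g {x, y} = gs n {x, y}" if "x \<in> M'" "y \<in> M'" for x y
    proof -
      have "\<beta> x = n" "\<beta> y = n" using M'(1) that by blast+
      then show ?thesis by (simp add: g_def)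
    qed
    then show "homogeneous (gs n) {a\<in>M'. h' a = j}"
      using h'[of j] unfolding homogeneous_def by simp
  qed
  then have "|M'| \<le>o |X n|"
    using countable_cover_leq[OF X_inf, of M' "\<lambda>j. {a\<in>M'. h' a = j}"] by blast
  then have "|M'| <o |M|" using X_small by (rule ordLeq_ordLess_trans)
  moreover have "|M| \<le>o |M'|"
    using ordIso_transitive[OF M(2) ordIso_symmetric[OF M'(2)]] by (rule ordIso_imp_ordLeq)
  ultimately show False using not_ordLess_ordLeq by blast
qed

theorem proposition1:
  fixes \<kappa> :: "'a rel" and l :: "'b rel"
  assumes "Card_order l" and "infinite (Field l)"
    and "Card_order \<kappa>"
    and "\<And>c :: 'a set \<Rightarrow> nat. coloring 3 (Fpow (Field \<kappa>)) c \<Longrightarrow>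
           \<exists>(H :: 'a set set) (b :: nat).
             unmeshed_family \<kappa> H \<and> |H| =o l \<and> even b \<and> b > 0 \<and> mono_under c (FU {b} H)"
  shows "arrows_pairs \<kappa> l"
  unfolding arrows_pairs_def
proof (intro allI impI, elim conjE)
  fix S :: "'a set" and f
  assume S: "|S| =o \<kappa>" and f: "coloring 2 ([S]\<^bsup>2\<^esup>) f"
  have Wl: "Well_order l" using assms(1) by (simp add: card_order_on_def)
  have SF: "|S| =o |Field \<kappa>|"
    using S ordIso_symmetric[OF card_of_Field_ordIso[OF assms(3)]] by (rule ordIso_transitive)
  show "\<exists>T\<subseteq>S. |T| =o l \<and> mono_under f ([T]\<^bsup>2\<^esup>)"
  proof (cases "l \<le>o |UNIV :: nat set|")
    case True
    have "infinite (Field \<kappa>)"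
    proof
      assume "finite (Field \<kappa>)"
      then have fin: "finite (Fpow (Field \<kappa>))"
        by (simp add: Fpow_def)
      have "coloring 3 (Fpow (Field \<kappa>)) (\<lambda>_. 0)" by (simp add: coloring_def)
      from assms(4)[OF this] obtain H where "unmeshed_family \<kappa> H" "|H| =o l" by blast
      then have "finite H" "|H| =o |Field l|"
        using finite_subset[OF _ fin, of H] ordIso_transitive
          ordIso_symmetric[OF card_of_Field_ordIso[OF assms(1)]]
        unfolding unmeshed_family_def by blast+
      then show False using card_of_ordIso_finite assms(2) by blast
    qed
    then have "infinite S" using card_of_ordIso_finite[OF SF] by simp
    from countable_arrows[OF assms(1) True this f] show ?thesis .
  next
    case False
    then have unc: "|UNIV :: nat set| <o l"
      using ordLess_or_ordLeq[OF card_of_Well_order Wl] by blast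
    obtain \<theta> where \<theta>: "bij_betw \<theta> (Field \<kappa>) S"
      using card_of_ordIso ordIso_symmetric[OF SF] by blast
    show ?thesis
    proof (rule ccontr)
      assume none: "\<not> ?thesis"
      have "|T| <o l" if T: "T \<subseteq> Field \<kappa>" "homogeneous (\<lambda>p. f (\<theta> ` p) = 1) T" for T
      proof (rule ccontr)
        assume "\<not> |T| <o l"
        then have "l \<le>o |T|" using ordLess_or_ordLeq[OF card_of_Well_order Wl] by blast
        then obtain U where U: "U \<subseteq> T" "|U| =o l"
          by (rule subset_of_cardinality[OF assms(1)])
        have inj: "inj_on \<theta> U"
          using \<theta> U(1) T(1) by (meson bij_betw_def inj_on_subset order_trans)
        have sub: "\<theta> ` U \<subseteq> S" using \<theta> U(1) T(1) unfolding bij_betw_def by blast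
        have "|U| =o |\<theta> ` U|" using inj by (meson card_of_ordIso inj_on_imp_bij_betw)
        then have "|\<theta> ` U| =o l"
          using U(2) ordIso_symmetric ordIso_transitive by blast
        moreover have "homogeneous (\<lambda>p. f p = 1) (\<theta> ` U)"
          using T(2) U(1) unfolding homogeneous_def by (simp add: subset_iff) metis
        then have "mono_under f ([\<theta> ` U]\<^bsup>2\<^esup>)"
          by (rule homogeneous_imp_mono_under[OF f sub])
        ultimately show False using none sub by blast
      qed
      from no_uncountable_counterexample[OF assms(1) unc assms(3,4) this] show False .
    qed
  qed
qed

end
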